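(* Let $n\ge2$, let $\mathcal{E},\mathcal{E}_*$ be Hilbert spaces and let $\Theta\in H^\infty_{\mathcal{B}(\mathcal{E},\mathcal{E}_* )}(\mathbb{D}^n)$ be a non-constant inner function on $\mathbb{D}^n$. Then $\dim\mathcal{Q}_\Theta=\infty$, where $\mathcal{Q}_\Theta=H^2_{\mathcal{E}_*}(\mathbb{D}^n)\ominus\Theta H^2_{\mathcal{E}}(\mathbb{D}^n)$.
   Context: Hilbert spaces are complex and separable. $H^2_{\mathcal{E}}(\mathbb{D}^n)$ is the $\mathcal{E}$-valued Hardy space over the polydisc. $H^\infty_{\mathcal{B}(\mathcal{E},\mathcal{E}_* )}(\mathbb{D}^n)$ is the space of bounded analytic $\mathcal{B}(\mathcal{E},\mathcal{E}_* )$-valued functions; $\Theta$ in it is inner if its boundary values satisfy $\Theta(z)^*\Theta(z)=I_{\mathcal{E}}$ for a.e. $z\in\mathbb{T}^n$. *)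

theory Defs
  imports "HOL-Analysis.Analysis" "HOL-Library.Function_Algebras"
begin

section \<open>Complex Hilbert spaces\<close>

class complex_vector = ab_group_add +
  fixes scaleC :: "complex \<Rightarrow> 'a \<Rightarrow> 'a"  (infixr \<open>*\<^sub>C\<close> 75)
  assumes scaleC_add_right: "a *\<^sub>C (x + y) = a *\<^sub>C x + a *\<^sub>C y"
    and scaleC_add_left: "(a + b) *\<^sub>C x = a *\<^sub>C x + b *\<^sub>C x"
    and scaleC_scaleC: "a *\<^sub>C b *\<^sub>C x = (a * b) *\<^sub>C x"
    and scaleC_one: "1 *\<^sub>C x = x"

global_interpretation complex_vector:
  vector_space "scaleC :: complex \<Rightarrow> 'a \<Rightarrow> 'a::complex_vector"
  by unfold_locales (fact scaleC_add_right scaleC_add_left scaleC_scaleC scaleC_one)+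

class complex_normed_vector = complex_vector + real_normed_vector +
  assumes scaleR_scaleC: "r *\<^sub>R x = complex_of_real r *\<^sub>C x"
    and norm_scaleC: "norm (a *\<^sub>C x) = cmod a * norm x"

text \<open>The inner product is linear in its first argument.\<close>

class complex_inner = complex_normed_vector +
  fixes cinner :: "'a \<Rightarrow> 'a \<Rightarrow> complex"
  assumes cinner_commute: "cinner x y = cnj (cinner y x)"
    and cinner_add_left: "cinner (x + y) z = cinner x z + cinner y z"
    and cinner_scaleC_left: "cinner (a *\<^sub>C x) y = a * cinner x y"
    and cinner_norm: "cinner x x = complex_of_real ((norm x)\<^sup>2)"

text \<open>Separability is expressed separately, by the sort \<^class>\<open>second_countable_topology\<close>.\<close>

class chilbert_space = complex_inner + banach

instantiation complex :: chilbert_space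
begin

definition scaleC_complex :: "complex \<Rightarrow> complex \<Rightarrow> complex"
  where "scaleC_complex a x = a * x"

definition cinner_complex :: "complex \<Rightarrow> complex \<Rightarrow> complex"
  where "cinner_complex x y = x * cnj y"

instance
  by standard
    (auto simp: scaleC_complex_def cinner_complex_def algebra_simps scaleR_conv_of_real
       norm_mult complex_norm_square [symmetric] simp flip: of_real_power)

end

instantiation "fun" :: (type, complex_vector) complex_vector
begin

definition scaleC_fun :: "complex \<Rightarrow> ('a \<Rightarrow> 'b) \<Rightarrow> 'a \<Rightarrow> 'b"
  where "scaleC_fun c f = (\<lambda>x. c *\<^sub>C f x)"

instance
  by standard
    (auto simp: scaleC_fun_def fun_eq_iff scaleC_add_right scaleC_add_left scaleC_scaleC scaleC_one)

end

definition infinite_dimensional :: "'a::complex_vector set \<Rightarrow> bool"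
  where "infinite_dimensional V \<longleftrightarrow>
    \<not> (\<exists>B. finite B \<and> B \<subseteq> V \<and> V \<subseteq> complex_vector.span B)"


section \<open>Bounded operators\<close>

lemma bounded_linear_scaleC: "bounded_linear (\<lambda>x::'a::complex_normed_vector. c *\<^sub>C x)"
  by (rule bounded_linear_intro [where K = "cmod c"])
    (auto simp: scaleC_add_right scaleR_scaleC scaleC_scaleC norm_scaleC mult.commute)

lemma bounded_linear_scaleC_blinfun:
  "bounded_linear (\<lambda>x. c *\<^sub>C blinfun_apply T x :: 'b::complex_normed_vector)"
  by (rule bounded_linear_compose [OF bounded_linear_scaleC blinfun.bounded_linear_right])

instantiation blinfun :: (real_normed_vector, complex_normed_vector) complex_normed_vector
begin

definition scaleC_blinfun :: "complex \<Rightarrow> ('a \<Rightarrow>\<^sub>L 'b) \<Rightarrow> 'a \<Rightarrow>\<^sub>L 'b"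
  where "scaleC_blinfun c T = Blinfun (\<lambda>x. c *\<^sub>C blinfun_apply T x)"

lemma blinfun_apply_scaleC: "blinfun_apply (c *\<^sub>C T) x = c *\<^sub>C blinfun_apply T x"
  for T :: "'a \<Rightarrow>\<^sub>L 'b"
  by (simp add: scaleC_blinfun_def bounded_linear_Blinfun_apply bounded_linear_scaleC_blinfun)

instance
proof
  fix a b :: complex and r :: real and T U :: "'a \<Rightarrow>\<^sub>L 'b"
  show "a *\<^sub>C (T + U) = a *\<^sub>C T + a *\<^sub>C U" "(a + b) *\<^sub>C T = a *\<^sub>C T + b *\<^sub>C T"
    "a *\<^sub>C b *\<^sub>C T = (a * b) *\<^sub>C T" "1 *\<^sub>C T = T" "r *\<^sub>R T = complex_of_real r *\<^sub>C T"
    by (auto intro!: blinfun_eqI simp: blinfun_apply_scaleC blinfun.add_left blinfun.scaleR_left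
        scaleC_add_right scaleC_add_left scaleC_scaleC scaleC_one scaleR_scaleC)
  have le: "norm (c *\<^sub>C V) \<le> cmod c * norm V" for c and V :: "'a \<Rightarrow>\<^sub>L 'b"
  proof (rule norm_blinfun_bound)
    fix x
    show "norm (blinfun_apply (c *\<^sub>C V) x) \<le> cmod c * norm V * norm x"
      using norm_blinfun [of V x]
      by (simp add: blinfun_apply_scaleC norm_scaleC mult.assoc mult_left_mono)
  qed simp
  show "norm (a *\<^sub>C T) = cmod a * norm T"
  proof (cases "a = 0")
    case True
    then show ?thesis using le [of a T] by simp
  next
    case False
    have "T = inverse a *\<^sub>C a *\<^sub>C T"
      using False by (auto intro!: blinfun_eqI simp: blinfun_apply_scaleC scaleC_scaleC scaleC_one)
    then have "norm T \<le> inverse (cmod a) * norm (a *\<^sub>C T)"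
      using le [of "inverse a" "a *\<^sub>C T"] by (simp add: norm_inverse)
    then show ?thesis
      using le [of a T] False by (simp add: field_simps)
  qed
qed

end

text \<open>
  \<open>'a \<Rightarrow>\<^sub>L 'b\<close> consists of the real-linear bounded operators; the complex-linear ones form
  the space \<open>B(\<E>, \<E>\<^sub>*)\<close>, and the norm of \<open>'a \<Rightarrow>\<^sub>L 'b\<close> is the operator norm.
\<close>

definition bounded_ops :: "('a::complex_normed_vector \<Rightarrow>\<^sub>L 'b::complex_normed_vector) set"
  where "bounded_ops = {T. \<forall>c x. blinfun_apply T (c *\<^sub>C x) = c *\<^sub>C blinfun_apply T x}"

definition is_adjoint :: "('b::chilbert_space \<Rightarrow>\<^sub>L 'a::chilbert_space) \<Rightarrow> ('a \<Rightarrow>\<^sub>L 'b) \<Rightarrow> bool"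
  where "is_adjoint S T \<longleftrightarrow> S \<in> bounded_ops \<and>
    (\<forall>x y. cinner (blinfun_apply T x) y = cinner x (blinfun_apply S y))"


section \<open>Analytic functions and the Hardy space on the polydisc\<close>

definition polydisc :: "(complex ^ 'n) set"
  where "polydisc = {z. \<forall>i. cmod (z $ i) < 1}"

definition monomial :: "('n::finite \<Rightarrow> nat) \<Rightarrow> complex ^ 'n \<Rightarrow> complex"
  where "monomial k z = (\<Prod>i\<in>UNIV. (z $ i) ^ k i)"

text \<open>
  As is usual for Hardy spaces, analyticity on the polydisc means being the sum there of a power
  series \<open>\<Sum>k. z\<^sup>k a k\<close> over the multi-indices \<open>k\<close>, with coefficients in the target space.
\<close>

definition has_power_series ::
    "(complex ^ 'n::finite \<Rightarrow> 'a::complex_normed_vector) \<Rightarrow> (('n \<Rightarrow> nat) \<Rightarrow> 'a) \<Rightarrow> bool"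
  where "has_power_series f a \<longleftrightarrow>
    (\<forall>z\<in>polydisc. ((\<lambda>k. monomial k z *\<^sub>C a k) has_sum f z) UNIV)"

definition taylor_coeff ::
    "(complex ^ 'n::finite \<Rightarrow> 'a::complex_normed_vector) \<Rightarrow> ('n \<Rightarrow> nat) \<Rightarrow> 'a"
  where "taylor_coeff f = (THE a. has_power_series f a)"

text \<open>
  Functions on the polydisc are represented by total functions that vanish outside it, so that
  equality and linear (in)dependence in \<open>hardy_space\<close> are those of functions on the polydisc.
\<close>

definition hardy_space :: "(complex ^ 'n::finite \<Rightarrow> 'a::chilbert_space) set"
  where "hardy_space = {f. (\<forall>z. z \<notin> polydisc \<longrightarrow> f z = 0) \<and>
    (\<exists>a. has_power_series f a \<and> (\<lambda>k. (norm (a k))\<^sup>2) summable_on UNIV)}"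

definition hardy_inner ::
    "(complex ^ 'n::finite \<Rightarrow> 'a::chilbert_space) \<Rightarrow> (complex ^ 'n \<Rightarrow> 'a) \<Rightarrow> complex"
  where "hardy_inner f g = (\<Sum>\<^sub>\<infinity>k. cinner (taylor_coeff f k) (taylor_coeff g k))"

text \<open>
  Values of \<open>\<Theta>\<close> outside the polydisc are irrelevant.
\<close>

definition bounded_analytic ::
    "(complex ^ 'n::finite \<Rightarrow> 'a::chilbert_space \<Rightarrow>\<^sub>L 'b::chilbert_space) \<Rightarrow> bool"
  where "bounded_analytic \<Theta> \<longleftrightarrow>
    (\<forall>z\<in>polydisc. \<Theta> z \<in> bounded_ops) \<and>
    (\<exists>A. (\<forall>k. A k \<in> bounded_ops) \<and> has_power_series \<Theta> A) \<and>
    bounded (\<Theta> ` polydisc)"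


section \<open>Inner functions\<close>

text \<open>Normalised Lebesgue measure on the torus, as a measure on the ambient space.\<close>

definition torus_measure :: "(complex ^ 'n::finite) measure"
  where "torus_measure =
    distr (uniform_measure lborel (cbox 0 (\<chi> i. 2 * pi) :: (real ^ 'n) set)) borel
      (\<lambda>t. \<chi> i. cis (t $ i))"

text \<open>Boundary values of operator-valued functions are radial limits in the strong operator
  topology; for bounded analytic functions these exist almost everywhere on the torus.\<close>

definition has_boundary_value ::
    "(complex ^ 'n::finite \<Rightarrow> 'a::chilbert_space \<Rightarrow>\<^sub>L 'b::chilbert_space) \<Rightarrow>
      complex ^ 'n \<Rightarrow> ('a \<Rightarrow>\<^sub>L 'b) \<Rightarrow> bool"
  where "has_boundary_value \<Theta> z T \<longleftrightarrow> T \<in> bounded_ops \<and>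
    (\<forall>x. ((\<lambda>r::real. blinfun_apply (\<Theta> (r *\<^sub>R z)) x) \<longlongrightarrow> blinfun_apply T x) (at_left 1))"

definition inner_function ::
    "(complex ^ 'n::finite \<Rightarrow> 'a::chilbert_space \<Rightarrow>\<^sub>L 'b::chilbert_space) \<Rightarrow> bool"
  where "inner_function \<Theta> \<longleftrightarrow> bounded_analytic \<Theta> \<and>
    (AE z in torus_measure.
      \<exists>T S. has_boundary_value \<Theta> z T \<and> is_adjoint S T \<and> S o\<^sub>L T = id_blinfun)"

definition nonconstant_on_polydisc :: "(complex ^ 'n::finite \<Rightarrow> 'a) \<Rightarrow> bool"
  where "nonconstant_on_polydisc \<Theta> \<longleftrightarrow> \<not> (\<exists>T. \<forall>z\<in>polydisc. \<Theta> z = T)"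

definition mult_range ::
    "(complex ^ 'n::finite \<Rightarrow> 'a::chilbert_space \<Rightarrow>\<^sub>L 'b::chilbert_space) \<Rightarrow>
      (complex ^ 'n \<Rightarrow> 'b) set"
  where "mult_range \<Theta> = (\<lambda>h z. blinfun_apply (\<Theta> z) (h z)) ` hardy_space"

definition model_space ::
    "(complex ^ 'n::finite \<Rightarrow> 'a::chilbert_space \<Rightarrow>\<^sub>L 'b::chilbert_space) \<Rightarrow>
      (complex ^ 'n \<Rightarrow> 'b) set"
  where "model_space \<Theta> = {f \<in> hardy_space. \<forall>g \<in> mult_range \<Theta>. hardy_inner f g = 0}"

end

theory Submission
  imports Defs "HOL-Computational_Algebra.Fundamental_Theorem_Algebra"
begin

text \<open>
  Passing to Taylor coefficients, the Hardy space becomes the Hilbert space \<open>ell2\<close> of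
  square-summable families indexed by multi-indices, and multiplication by \<open>\<Theta>\<close> becomes a Cauchy
  product \<open>V\<close>. Since the boundary values of \<open>\<Theta>\<close> are isometries, Parseval's identity on the tori of
  radius \<open>r\<close> and dominated convergence as \<open>r\<close> tends to \<open>1\<close> show that \<open>V\<close> is isometric on polynomials,
  hence everywhere (\<open>inner_function_polynomial_norm\<close>, \<open>norm_mult_op\<close>). It commutes with the shifts
  \<open>S\<^sub>i\<close>, the multiplications by the coordinate functions, and its range \<open>W\<close> is closed.

  Suppose that the model space, the orthogonal complement of \<open>W\<close>, is finite-dimensional, and that
  \<open>W\<close> is not the whole space. As the \<open>S\<^sub>i\<close> commute and map \<open>W\<close> into itself, two distinct shifts
  \<open>S\<^sub>i\<close>, \<open>S\<^sub>j\<close> have a common eigenvector \<open>f\<close> modulo \<open>W\<close> (\<open>eigenvector_modulo_subspace\<close>, applied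
  twice): \<open>f\<close> is not in \<open>W\<close>, while \<open>(S\<^sub>i - a) f = V g\<^sub>1\<close> and \<open>(S\<^sub>j - b) f = V g\<^sub>2\<close>. The compression of
  \<open>S\<^sub>i\<close> to the model space is a contraction without eigenvalues of modulus \<open>1\<close>, so \<open>\<bar>a\<bar> < 1\<close>. As \<open>V\<close>
  is injective, \<open>(S\<^sub>j - b) g\<^sub>1 = (S\<^sub>i - a) g\<^sub>2\<close>. Now \<open>z\<^sub>i - a\<close> and \<open>z\<^sub>j - b\<close> are coprime: restricting to
  \<open>z\<^sub>i = a\<close> shows that \<open>g\<^sub>1\<close> vanishes there, so \<open>g\<^sub>1 = (S\<^sub>i - a) u\<close> with \<open>u\<close> in the Hardy space
  (\<open>shift_coprime\<close>). Therefore \<open>f = V u\<close> lies in \<open>W\<close>, a contradiction. This is the only place where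
  two variables are needed.

  Hence \<open>V\<close> is unitary (\<open>finite_codim_isometry_surj\<close>). A unitary operator commuting with the shifts
  preserves the orthogonal complements of their ranges; their intersection consists of the constants,
  so \<open>\<Theta>\<close> maps constant functions to constant functions and is itself constant.
\<close>


section \<open>Complex inner product spaces\<close>

lemma cinner_add_right: "cinner x (y + z) = cinner x y + cinner x (z::'a::complex_inner)"
  by (metis cinner_add_left cinner_commute complex_cnj_add)

lemma cinner_scaleC_right: "cinner x (c *\<^sub>C y) = cnj c * cinner x (y::'a::complex_inner)"
  by (metis cinner_scaleC_left cinner_commute complex_cnj_mult)

lemma cinner_zero_left [simp]: "cinner 0 (y::'a::complex_inner) = 0"
  using cinner_scaleC_left [of 0 0 y] by simp

lemma cinner_zero_right [simp]: "cinner (x::'a::complex_inner) 0 = 0"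
  using cinner_scaleC_right [of x 0 0] by simp

lemma cinner_minus_left: "cinner (- x) y = - cinner x (y::'a::complex_inner)"
  using cinner_add_left [of x "- x" y] by (simp add: add_eq_0_iff)

lemma cinner_minus_right: "cinner x (- y) = - cinner x (y::'a::complex_inner)"
  using cinner_add_right [of x y "- y"] by (simp add: add_eq_0_iff)

lemma cinner_diff_left: "cinner (x - y) z = cinner x z - cinner y (z::'a::complex_inner)"
  using cinner_add_left [of x "- y" z] by (simp add: cinner_minus_left)

lemma cinner_sum_left: "cinner (\<Sum>i\<in>I. f i) y = (\<Sum>i\<in>I. cinner (f i) (y::'a::complex_inner))"
  by (induction I rule: infinite_finite_induct) (auto simp: cinner_add_left)

lemma cinner_sum_right: "cinner x (\<Sum>i\<in>I. f i) = (\<Sum>i\<in>I. cinner (x::'a::complex_inner) (f i))"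
  by (induction I rule: infinite_finite_induct) (auto simp: cinner_add_right)

lemma cinner_self_eq_0: "cinner x x = 0 \<longleftrightarrow> (x::'a::complex_inner) = 0"
  by (simp add: cinner_norm)

lemma norm_add_sq:
  "(norm (x + y))\<^sup>2 = (norm x)\<^sup>2 + (norm y)\<^sup>2 + 2 * Re (cinner x (y::'a::complex_inner))"
proof -
  have "complex_of_real ((norm (x + y))\<^sup>2) = cinner (x + y) (x + y)"
    by (simp add: cinner_norm)
  also have "\<dots> = cinner x x + cinner y y + (cinner x y + cinner y x)"
    by (simp add: cinner_add_left cinner_add_right)
  also have "cinner y x = cnj (cinner x y)"
    by (rule cinner_commute)
  also have "cinner x y + cnj (cinner x y) = complex_of_real (2 * Re (cinner x y))"
    by (simp add: complex_add_cnj)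
  finally have "complex_of_real ((norm (x + y))\<^sup>2) =
      complex_of_real ((norm x)\<^sup>2 + (norm y)\<^sup>2 + 2 * Re (cinner x y))"
    by (simp add: cinner_norm)
  then show ?thesis
    using of_real_eq_iff by blast
qed

lemma norm_diff_sq:
  "(norm (x - y))\<^sup>2 = (norm x)\<^sup>2 + (norm y)\<^sup>2 - 2 * Re (cinner x (y::'a::complex_inner))"
  using norm_add_sq [of x "- y"] by (simp add: cinner_minus_right)

lemma norm_add_sq_orthogonal:
  assumes "cinner x (y::'a::complex_inner) = 0"
  shows "(norm (x + y))\<^sup>2 = (norm x)\<^sup>2 + (norm y)\<^sup>2"
  using norm_add_sq [of x y] assms by simp

lemma cinner_Cauchy_Schwarz: "cmod (cinner x y) \<le> norm x * norm (y::'a::complex_inner)"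
proof (cases "y = 0")
  case False
  define c where "c = cinner x y / complex_of_real ((norm y)\<^sup>2)"
  have "cinner (x - c *\<^sub>C y) (c *\<^sub>C y) = 0"
    using False
    by (simp add: cinner_diff_left cinner_scaleC_left cinner_scaleC_right cinner_norm c_def)
  from norm_add_sq_orthogonal [OF this] have "(norm (c *\<^sub>C y))\<^sup>2 \<le> (norm x)\<^sup>2"
    by simp
  then have "norm (c *\<^sub>C y) \<le> norm x"
    by (rule power2_le_imp_le) simp
  then show ?thesis
    using False
    by (simp add: norm_scaleC c_def norm_divide norm_power power2_eq_square pos_divide_le_eq
        del: of_real_power of_real_mult)
qed simp

text \<open>Polarisation: the norm of a complex inner product space determines the inner product.\<close>

lemma isometry_preserves_cinner:
  fixes V :: "'a::complex_inner \<Rightarrow> 'b::complex_inner"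
  assumes add: "\<And>x y. V (x + y) = V x + V y"
    and scale: "\<And>c x. V (c *\<^sub>C x) = c *\<^sub>C V x"
    and norm: "\<And>x. norm (V x) = norm x"
  shows "cinner (V x) (V y) = cinner x y"
proof -
  have Re: "Re (cinner (V x) (V y)) = Re (cinner x y)" for x y
    using norm_add_sq [of "V x" "V y"] norm_add_sq [of x y] by (simp add: norm flip: add)
  have "Im (cinner (V x) (V y)) = Im (cinner x y)"
    using Re [of "(- \<i>) *\<^sub>C x" y]
    by (simp add: scale cinner_scaleC_left del: complex_vector.scale_minus_left)
  then show ?thesis
    using Re by (simp add: complex_eq_iff)
qed

lemma orthogonal_projection_exists:
  fixes W :: "'a::complex_inner set"
  assumes complete: "complete W" and zero: "0 \<in> W"
    and add: "\<And>x y. x \<in> W \<Longrightarrow> y \<in> W \<Longrightarrow> x + y \<in> W"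
    and scale: "\<And>c x. x \<in> W \<Longrightarrow> c *\<^sub>C x \<in> W"
  shows "\<exists>p\<in>W. \<forall>w\<in>W. cinner (x - p) w = 0"
proof -
  define d where "d = Inf ((\<lambda>w. (norm (x - w))\<^sup>2) ` W)"
  have bdd: "bdd_below ((\<lambda>w. (norm (x - w))\<^sup>2) ` W)"
    by (rule bdd_belowI2 [where m = 0]) simp
  have d_le: "d \<le> (norm (x - w))\<^sup>2" if "w \<in> W" for w
    unfolding d_def using bdd that by (rule cINF_lower)
  have "\<exists>w\<in>W. (norm (x - w))\<^sup>2 < d + e" if "e > 0" for e
    using cINF_less_iff [OF _ bdd, of "d + e"] that zero by (auto simp: d_def [symmetric])
  then have "\<exists>w\<in>W. (norm (x - w))\<^sup>2 < d + 1 / real (Suc n)" for n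
    by simp
  then obtain w where wW: "\<And>n. w n \<in> W" and w: "\<And>n. (norm (x - w n))\<^sup>2 < d + 1 / real (Suc n)"
    by metis
  have scaleR: "r *\<^sub>R y \<in> W" if "y \<in> W" for r y
    using scale [OF that] by (simp add: scaleR_scaleC)
  \<comment> \<open>parallelogram law, with the midpoint of two approximants as competitor\<close>
  have key: "(norm (w m - w n))\<^sup>2 \<le> 2 / real (Suc m) + 2 / real (Suc n)" for m n
  proof -
    define a b where "a = x - w m" and "b = x - w n"
    have "(norm (a - b))\<^sup>2 + (norm (a + b))\<^sup>2 = 2 * (norm a)\<^sup>2 + 2 * (norm b)\<^sup>2"
      by (simp add: norm_diff_sq norm_add_sq)
    moreover have "a + b = 2 *\<^sub>R (x - (1/2) *\<^sub>R (w m + w n))"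
      by (simp add: a_def b_def algebra_simps scaleR_2)
    then have "(norm (a + b))\<^sup>2 = 4 * (norm (x - (1/2) *\<^sub>R (w m + w n)))\<^sup>2"
      by (simp add: power_mult_distrib)
    moreover have "(1/2) *\<^sub>R (w m + w n) \<in> W"
      by (intro scaleR add wW)
    ultimately have "(norm (a - b))\<^sup>2 \<le> 2 * (norm a)\<^sup>2 + 2 * (norm b)\<^sup>2 - 4 * d"
      using d_le by fastforce
    moreover have "(norm (a - b))\<^sup>2 = (norm (w m - w n))\<^sup>2"
      by (simp add: a_def b_def norm_minus_commute)
    ultimately show ?thesis
      using w [of m] w [of n] by (simp add: a_def b_def)
  qed
  have "Cauchy w"
  proof (rule metric_CauchyI)
    fix e :: real assume "e > 0"
    then have "eventually (\<lambda>n. 1 / real (Suc n) < e\<^sup>2 / 4) sequentially"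
      by (intro order_tendstoD(2) [OF LIMSEQ_inverse_real_of_nat, unfolded inverse_eq_divide]) simp
    then obtain N where N: "\<And>n. n \<ge> N \<Longrightarrow> 1 / real (Suc n) < e\<^sup>2 / 4"
      by (auto simp: eventually_sequentially)
    show "\<exists>M. \<forall>m\<ge>M. \<forall>n\<ge>M. dist (w m) (w n) < e"
    proof (intro exI allI impI)
      fix m n assume "m \<ge> N" "n \<ge> N"
      then have "(norm (w m - w n))\<^sup>2 < e\<^sup>2"
        using key [of m n] N [of m] N [of n] by simp
      then show "dist (w m) (w n) < e"
        using \<open>e > 0\<close> by (simp add: dist_norm power2_less_imp_less)
    qed
  qed
  then obtain p where pW: "p \<in> W" and p: "w \<longlonglongrightarrow> p"
    using complete wW by (auto simp: complete_def)
  have "(\<lambda>n. (norm (x - w n))\<^sup>2) \<longlonglongrightarrow> (norm (x - p))\<^sup>2"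
    by (intro tendsto_intros p)
  moreover have "(\<lambda>n. d + 1 / real (Suc n)) \<longlonglongrightarrow> d + 0"
    by (intro tendsto_add tendsto_const LIMSEQ_inverse_real_of_nat [unfolded inverse_eq_divide])
  ultimately have p_le: "(norm (x - p))\<^sup>2 \<le> d"
    using w by (intro LIMSEQ_le [where X = "\<lambda>n. (norm (x - w n))\<^sup>2"
          and Y = "\<lambda>n. d + 1 / real (Suc n)"]) (auto intro: less_imp_le)
  have "cinner (x - p) v = 0" if v: "v \<in> W" for v
  proof (cases "v = 0")
    case False
    define c where "c = cinner (x - p) v / complex_of_real ((norm v)\<^sup>2)"
    have orth: "cinner (x - p - c *\<^sub>C v) (c *\<^sub>C v) = 0"
      using False
      by (simp add: cinner_diff_left cinner_scaleC_left cinner_scaleC_right cinner_norm c_def)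
    have "d \<le> (norm (x - (p + c *\<^sub>C v)))\<^sup>2"
      by (intro d_le add pW scale v)
    moreover have "(norm (x - p))\<^sup>2 = (norm (x - (p + c *\<^sub>C v)))\<^sup>2 + (norm (c *\<^sub>C v))\<^sup>2"
      using norm_add_sq_orthogonal [OF orth] by (simp add: algebra_simps)
    ultimately have "(norm (c *\<^sub>C v))\<^sup>2 \<le> 0"
      using p_le by linarith
    then have "c = 0"
      using False by (simp add: norm_scaleC)
    then show ?thesis
      using False by (simp add: c_def)
  qed simp
  with pW show ?thesis
    by blast
qed


section \<open>The Hilbert space of square-summable families\<close>

text \<open>Square-summable families over an arbitrary index type; Hardy space elements are represented
  by their families of Taylor coefficients.\<close>

typedef (overloaded) ('i, 'a) ell2 =
    "{f :: 'i \<Rightarrow> 'a::complex_normed_vector. (\<lambda>k. (norm (f k))\<^sup>2) summable_on UNIV}"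
  morphisms entry Abs_ell2
  by (rule exI [of _ "\<lambda>_. 0"]) simp

setup_lifting type_definition_ell2

lemma ell2_eqI: "(\<And>k. entry f k = entry g k) \<Longrightarrow> f = g"
  by (metis ext entry_inject)

lemma sq_summableI:
  fixes f :: "'i \<Rightarrow> 'a::real_normed_vector"
  assumes "\<And>F. finite F \<Longrightarrow> (\<Sum>k\<in>F. (norm (f k))\<^sup>2) \<le> B"
  shows "(\<lambda>k. (norm (f k))\<^sup>2) summable_on UNIV"
  by (rule nonneg_bdd_above_summable_on) (auto intro!: bdd_aboveI2 [where M = B] assms)

lemma sq_summable_entry: "(\<lambda>k. (norm (entry f k))\<^sup>2) summable_on UNIV"
  using entry [of f] by simp

lemma L2_set_le_sqrt_infsum:
  fixes f :: "'i \<Rightarrow> 'a::real_normed_vector"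
  assumes "(\<lambda>k. (norm (f k))\<^sup>2) summable_on UNIV" "finite F"
  shows "L2_set (\<lambda>k. norm (f k)) F \<le> sqrt (\<Sum>\<^sub>\<infinity>k. (norm (f k))\<^sup>2)"
  unfolding L2_set_def using assms by (intro real_sqrt_le_mono finite_sum_le_infsum) auto

lemma L2_set_add_le:
  fixes f g :: "'i \<Rightarrow> 'a::real_normed_vector"
  assumes "(\<lambda>k. (norm (f k))\<^sup>2) summable_on UNIV" "(\<lambda>k. (norm (g k))\<^sup>2) summable_on UNIV" "finite F"
  shows "L2_set (\<lambda>k. norm (f k + g k)) F \<le>
    sqrt (\<Sum>\<^sub>\<infinity>k. (norm (f k))\<^sup>2) + sqrt (\<Sum>\<^sub>\<infinity>k. (norm (g k))\<^sup>2)"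
proof -
  have "L2_set (\<lambda>k. norm (f k + g k)) F \<le> L2_set (\<lambda>k. norm (f k) + norm (g k)) F"
    by (intro L2_set_mono norm_triangle_ineq) auto
  also have "\<dots> \<le> L2_set (\<lambda>k. norm (f k)) F + L2_set (\<lambda>k. norm (g k)) F"
    by (rule L2_set_triangle_ineq)
  also have "\<dots> \<le> sqrt (\<Sum>\<^sub>\<infinity>k. (norm (f k))\<^sup>2) + sqrt (\<Sum>\<^sub>\<infinity>k. (norm (g k))\<^sup>2)"
    using assms by (intro add_mono L2_set_le_sqrt_infsum)
  finally show ?thesis .
qed

lemma sum_sq_le_of_L2_set_le:
  assumes "L2_set f F \<le> B"
  shows "(\<Sum>k\<in>F. (f k)\<^sup>2) \<le> B\<^sup>2"
  using power_mono [OF assms L2_set_nonneg, of 2] by (simp add: L2_set_def sum_nonneg)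

lemma sq_summable_add:
  fixes f g :: "'i \<Rightarrow> 'a::real_normed_vector"
  assumes "(\<lambda>k. (norm (f k))\<^sup>2) summable_on UNIV" "(\<lambda>k. (norm (g k))\<^sup>2) summable_on UNIV"
  shows "(\<lambda>k. (norm (f k + g k))\<^sup>2) summable_on UNIV"
  by (rule sq_summableI, rule sum_sq_le_of_L2_set_le, rule L2_set_add_le [OF assms])

lemma sq_summable_scaleC:
  fixes f :: "'i \<Rightarrow> 'a::complex_normed_vector"
  assumes "(\<lambda>k. (norm (f k))\<^sup>2) summable_on UNIV"
  shows "(\<lambda>k. (norm (c *\<^sub>C f k))\<^sup>2) summable_on UNIV"
proof -
  have "(\<lambda>k. (cmod c)\<^sup>2 * (norm (f k))\<^sup>2) summable_on UNIV"
    by (intro summable_on_cmult_right assms)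
  then show ?thesis
    by (simp add: norm_scaleC power_mult_distrib)
qed

instantiation ell2 :: (type, complex_normed_vector) complex_normed_vector
begin

lift_definition zero_ell2 :: "('a, 'b) ell2" is "\<lambda>_. 0"
  by simp

lift_definition plus_ell2 :: "('a, 'b) ell2 \<Rightarrow> ('a, 'b) ell2 \<Rightarrow> ('a, 'b) ell2"
  is "\<lambda>f g k. f k + g k"
  by (rule sq_summable_add)

lift_definition uminus_ell2 :: "('a, 'b) ell2 \<Rightarrow> ('a, 'b) ell2" is "\<lambda>f k. - f k"
  by simp

lift_definition minus_ell2 :: "('a, 'b) ell2 \<Rightarrow> ('a, 'b) ell2 \<Rightarrow> ('a, 'b) ell2"
  is "\<lambda>f g k. f k - g k"
  using sq_summable_add [where g = "\<lambda>k. - g k" for g] by simp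

lift_definition scaleC_ell2 :: "complex \<Rightarrow> ('a, 'b) ell2 \<Rightarrow> ('a, 'b) ell2" is "\<lambda>c f k. c *\<^sub>C f k"
  by (rule sq_summable_scaleC)

definition scaleR_ell2 :: "real \<Rightarrow> ('a, 'b) ell2 \<Rightarrow> ('a, 'b) ell2"
  where "scaleR_ell2 r f = complex_of_real r *\<^sub>C f"

definition norm_ell2 :: "('a, 'b) ell2 \<Rightarrow> real"
  where "norm_ell2 f = sqrt (\<Sum>\<^sub>\<infinity>k. (norm (entry f k))\<^sup>2)"

definition dist_ell2 :: "('a, 'b) ell2 \<Rightarrow> ('a, 'b) ell2 \<Rightarrow> real"
  where "dist_ell2 f g = norm (f - g)"

definition sgn_ell2 :: "('a, 'b) ell2 \<Rightarrow> ('a, 'b) ell2"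
  where "sgn_ell2 f = inverse (norm f) *\<^sub>R f"

definition uniformity_ell2 :: "(('a, 'b) ell2 \<times> ('a, 'b) ell2) filter"
  where "uniformity_ell2 = (INF e\<in>{0<..}. principal {(x, y). dist x y < e})"

definition open_ell2 :: "('a, 'b) ell2 set \<Rightarrow> bool"
  where "open_ell2 U \<longleftrightarrow> (\<forall>x\<in>U. eventually (\<lambda>(x', y). x' = x \<longrightarrow> y \<in> U) uniformity)"

lemma norm_ell2_sq: "(norm f)\<^sup>2 = (\<Sum>\<^sub>\<infinity>k. (norm (entry f k))\<^sup>2)"
  for f :: "('a, 'b) ell2"
  unfolding norm_ell2_def by (intro real_sqrt_pow2 infsum_nonneg) simp

lemma norm_ell2_leI:
  fixes f :: "('a, 'b) ell2"
  assumes "\<And>F. finite F \<Longrightarrow> (\<Sum>k\<in>F. (norm (entry f k))\<^sup>2) \<le> B\<^sup>2" "B \<ge> 0"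
  shows "norm f \<le> B"
proof -
  have "norm f \<le> sqrt (B\<^sup>2)"
    unfolding norm_ell2_def
    by (intro real_sqrt_le_mono infsum_le_finite_sums sq_summable_entry assms)
  with assms(2) show ?thesis
    by simp
qed

lemma sum_sq_entry_le_norm:
  fixes f :: "('a, 'b) ell2"
  assumes "finite F"
  shows "(\<Sum>k\<in>F. (norm (entry f k))\<^sup>2) \<le> (norm f)\<^sup>2"
  unfolding norm_ell2_sq using assms by (intro finite_sum_le_infsum sq_summable_entry) auto

lemma norm_entry_le: "norm (entry f k) \<le> norm f"
  for f :: "('a, 'b) ell2"
  by (rule power2_le_imp_le)
    (use sum_sq_entry_le_norm [of "{k}" f] in \<open>auto simp: norm_ell2_def infsum_nonneg\<close>)

instance
proof
  fix x y z :: "('a, 'b) ell2" and a b :: complex and r :: real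
  show "x + y + z = x + (y + z)" "x + y = y + x" "0 + x = x" "- x + x = 0" "x - y = x + - y"
    by (transfer; simp add: fun_eq_iff algebra_simps)+
  show sc: "a *\<^sub>C (x + y) = a *\<^sub>C x + a *\<^sub>C y" "(a + b) *\<^sub>C x = a *\<^sub>C x + b *\<^sub>C x"
    "a *\<^sub>C b *\<^sub>C x = (a * b) *\<^sub>C x" "1 *\<^sub>C x = x" for a b :: complex and x y :: "('a, 'b) ell2"
    by (transfer; simp add: fun_eq_iff scaleC_add_right scaleC_add_left scaleC_scaleC scaleC_one)+
  show "r *\<^sub>R x = complex_of_real r *\<^sub>C x" for r and x :: "('a, 'b) ell2"
    by (rule scaleR_ell2_def)
  show "r *\<^sub>R (x + y) = r *\<^sub>R x + r *\<^sub>R y" "(r + s) *\<^sub>R x = r *\<^sub>R x + s *\<^sub>R x"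
    "r *\<^sub>R s *\<^sub>R x = (r * s) *\<^sub>R x" "1 *\<^sub>R x = x" for r s :: real and x y :: "('a, 'b) ell2"
    by (simp_all add: scaleR_ell2_def sc)
  show nsc: "norm (a *\<^sub>C x) = cmod a * norm x" for a and x :: "('a, 'b) ell2"
  proof -
    have "(\<Sum>\<^sub>\<infinity>k. (norm (entry (a *\<^sub>C x) k))\<^sup>2) = (\<Sum>\<^sub>\<infinity>k. (cmod a)\<^sup>2 * (norm (entry x k))\<^sup>2)"
      by (simp add: scaleC_ell2.rep_eq norm_scaleC power_mult_distrib)
    also have "\<dots> = (cmod a)\<^sup>2 * (\<Sum>\<^sub>\<infinity>k. (norm (entry x k))\<^sup>2)"
      by (intro infsum_cmult_right sq_summable_entry)
    finally show ?thesis
      by (simp add: norm_ell2_def real_sqrt_mult)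
  qed
  show "norm (r *\<^sub>R x) = \<bar>r\<bar> * norm x"
    by (simp add: scaleR_ell2_def nsc)
  show "dist x y = norm (x - y)" by (rule dist_ell2_def)
  show "sgn x = inverse (norm x) *\<^sub>R x" by (rule sgn_ell2_def)
  show "uniformity = (INF e\<in>{0<..}. principal {(x, y::('a, 'b) ell2). dist x y < e})"
    by (rule uniformity_ell2_def)
  show "open U \<longleftrightarrow> (\<forall>x\<in>U. eventually (\<lambda>(x', y). x' = x \<longrightarrow> y \<in> U) uniformity)"
    for U :: "('a, 'b) ell2 set"
    by (rule open_ell2_def)
  show "norm x = 0 \<longleftrightarrow> x = 0"
  proof
    assume "norm x = 0"
    then have "norm (entry x k) \<le> 0" for k
      using norm_entry_le [of x k] by simp
    then show "x = 0"
      by (intro ell2_eqI) (simp add: zero_ell2.rep_eq)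
  qed (simp add: norm_ell2_def zero_ell2.rep_eq)
  show "norm (x + y) \<le> norm x + norm y"
  proof (rule norm_ell2_leI)
    fix F :: "'a set" assume "finite F"
    then show "(\<Sum>k\<in>F. (norm (entry (x + y) k))\<^sup>2) \<le> (norm x + norm y)\<^sup>2"
      unfolding norm_ell2_def plus_ell2.rep_eq
      by (intro sum_sq_le_of_L2_set_le L2_set_add_le sq_summable_entry)
  qed (auto simp: norm_ell2_def infsum_nonneg)
qed

end

lemma entry_zero [simp]: "entry 0 k = 0"
  by (simp add: zero_ell2.rep_eq)

lemma entry_add: "entry (f + g) k = entry f k + entry g k"
  by (simp add: plus_ell2.rep_eq)

lemma entry_diff: "entry (f - g) k = entry f k - entry g k"
  by (simp add: minus_ell2.rep_eq)

lemma entry_scaleC: "entry (c *\<^sub>C f) k = c *\<^sub>C entry f k"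
  by (simp add: scaleC_ell2.rep_eq)

lemma bounded_linear_entry: "bounded_linear (\<lambda>f. entry f k)"
  by (rule bounded_linear_intro [where K = 1])
    (auto simp: entry_add scaleR_ell2_def entry_scaleC scaleR_scaleC norm_entry_le)

lemma abs_summable_cinner_entry:
  fixes f g :: "('i, 'a::complex_inner) ell2"
  shows "(\<lambda>k. norm (cinner (entry f k) (entry g k))) summable_on UNIV"
proof (rule Infinite_Sum.abs_summable_on_comparison_test')
  show "(\<lambda>k. (norm (entry f k))\<^sup>2 + (norm (entry g k))\<^sup>2) summable_on UNIV"
    by (intro summable_on_add sq_summable_entry)
  fix k
  have "cmod (cinner (entry f k) (entry g k)) \<le> norm (entry f k) * norm (entry g k)"
    by (rule cinner_Cauchy_Schwarz)
  also have "\<dots> \<le> (norm (entry f k))\<^sup>2 + (norm (entry g k))\<^sup>2"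
    using sum_squares_bound [of "norm (entry f k)" "norm (entry g k)"]
      mult_nonneg_nonneg [OF norm_ge_zero [of "entry f k"] norm_ge_zero [of "entry g k"]]
    by linarith
  finally show "cmod (cinner (entry f k) (entry g k)) \<le> (norm (entry f k))\<^sup>2 + (norm (entry g k))\<^sup>2" .
qed

lemmas summable_cinner_entry = abs_summable_summable [OF abs_summable_cinner_entry]

instantiation ell2 :: (type, chilbert_space) chilbert_space
begin

definition cinner_ell2 :: "('a, 'b) ell2 \<Rightarrow> ('a, 'b) ell2 \<Rightarrow> complex"
  where "cinner_ell2 f g = (\<Sum>\<^sub>\<infinity>k. cinner (entry f k) (entry g k))"

instance
proof
  fix x y z :: "('a, 'b) ell2" and a :: complex
  show "cinner x y = cnj (cinner y x)"
    unfolding cinner_ell2_def infsum_cnj [symmetric] by (simp flip: cinner_commute)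
  show "cinner (x + y) z = cinner x z + cinner y z"
    unfolding cinner_ell2_def
    by (simp add: entry_add cinner_add_left infsum_add summable_cinner_entry)
  show "cinner (a *\<^sub>C x) y = a * cinner x y"
    unfolding cinner_ell2_def
    by (simp add: entry_scaleC cinner_scaleC_left infsum_cmult_right summable_cinner_entry)
  have "((\<lambda>k. complex_of_real ((norm (entry x k))\<^sup>2)) has_sum complex_of_real ((norm x)\<^sup>2)) UNIV"
    unfolding norm_ell2_sq by (intro has_sum_of_real has_sum_infsum sq_summable_entry)
  then show "cinner x x = complex_of_real ((norm x)\<^sup>2)"
    unfolding cinner_ell2_def cinner_norm by (rule infsumI)
next
  fix X :: "nat \<Rightarrow> ('a, 'b) ell2"
  assume "Cauchy X"
  have "Cauchy (\<lambda>n. entry (X n) k)" for k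
    by (rule bounded_linear.Cauchy [OF bounded_linear_entry \<open>Cauchy X\<close>])
  then have "\<forall>k. \<exists>l. (\<lambda>n. entry (X n) k) \<longlonglongrightarrow> l"
    by (simp add: Cauchy_convergent_iff convergent_def)
  then obtain l where l: "\<And>k. (\<lambda>n. entry (X n) k) \<longlonglongrightarrow> l k"
    by metis
  have close: "\<exists>N. \<forall>m\<ge>N. \<forall>F. finite F \<longrightarrow> (\<Sum>k\<in>F. (norm (entry (X m) k - l k))\<^sup>2) \<le> e\<^sup>2"
    if e: "e > 0" for e
  proof -
    obtain N where N: "\<And>m n. m \<ge> N \<Longrightarrow> n \<ge> N \<Longrightarrow> norm (X m - X n) < e"
      using CauchyD [OF \<open>Cauchy X\<close> e] by blast
    have "(\<Sum>k\<in>F. (norm (entry (X m) k - l k))\<^sup>2) \<le> e\<^sup>2" if m: "m \<ge> N" and F: "finite F" for m F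
    proof (rule LIMSEQ_le_const2)
      show "(\<lambda>n. \<Sum>k\<in>F. (norm (entry (X m) k - entry (X n) k))\<^sup>2) \<longlonglongrightarrow>
          (\<Sum>k\<in>F. (norm (entry (X m) k - l k))\<^sup>2)"
        by (intro tendsto_intros l)
      have "(\<Sum>k\<in>F. (norm (entry (X m) k - entry (X n) k))\<^sup>2) \<le> e\<^sup>2" if n: "n \<ge> N" for n
      proof -
        have "(\<Sum>k\<in>F. (norm (entry (X m) k - entry (X n) k))\<^sup>2) \<le> (norm (X m - X n))\<^sup>2"
          using sum_sq_entry_le_norm [OF F, of "X m - X n"] by (simp add: entry_diff)
        also have "\<dots> \<le> e\<^sup>2"
          using N [OF m n] by (intro power_mono) auto
        finally show ?thesis .
      qed
      then show "\<exists>N. \<forall>n\<ge>N. (\<Sum>k\<in>F. (norm (entry (X m) k - entry (X n) k))\<^sup>2) \<le> e\<^sup>2"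
        by blast
    qed
    then show ?thesis
      by blast
  qed
  obtain M where M: "\<And>F. finite F \<Longrightarrow> (\<Sum>k\<in>F. (norm (entry (X M) k - l k))\<^sup>2) \<le> 1\<^sup>2"
    using close [of 1] by auto
  have "(\<lambda>k. (norm (entry (X M) k - l k))\<^sup>2) summable_on UNIV"
    using M by (rule sq_summableI)
  then have "(\<lambda>k. (norm (entry (X M) k + - (entry (X M) k - l k)))\<^sup>2) summable_on UNIV"
    by (intro sq_summable_add sq_summable_entry) (simp add: norm_minus_commute)
  then have "l \<in> {f. (\<lambda>k. (norm (f k))\<^sup>2) summable_on UNIV}"
    by simp
  then have L: "entry (Abs_ell2 l) k = l k" for k
    by (simp add: Abs_ell2_inverse)
  have "X \<longlonglongrightarrow> Abs_ell2 l"
  proof (rule LIMSEQ_I)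
    fix e :: real assume "e > 0"
    then obtain N where N: "\<And>m F. m \<ge> N \<Longrightarrow> finite F \<Longrightarrow>
        (\<Sum>k\<in>F. (norm (entry (X m) k - l k))\<^sup>2) \<le> (e / 2)\<^sup>2"
      using close [of "e / 2"] by auto
    have "norm (X m - Abs_ell2 l) \<le> e / 2" if "m \<ge> N" for m
      using N [OF that] \<open>e > 0\<close> by (intro norm_ell2_leI) (auto simp: entry_diff L)
    then show "\<exists>N. \<forall>m\<ge>N. norm (X m - Abs_ell2 l) < e"
      using \<open>e > 0\<close> by (intro exI [of _ N]) fastforce
  qed
  then show "convergent X"
    by (auto simp: convergent_def)
qed

end


section \<open>Power series on the polydisc\<close>

lemma summable_on_imp_bounded_terms:
  fixes f :: "'i \<Rightarrow> 'a::real_normed_vector"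
  assumes "f summable_on UNIV"
  shows "\<exists>M. \<forall>k. norm (f k) \<le> M"
proof -
  obtain S where "(sum f \<longlongrightarrow> S) (finite_subsets_at_top UNIV)"
    using assms by (auto simp: summable_on_def has_sum_def)
  then have "eventually (\<lambda>F. dist (sum f F) S < 1) (finite_subsets_at_top UNIV)"
    by (rule tendstoD) simp
  then obtain X where X: "finite X" and close: "\<And>F. finite F \<Longrightarrow> X \<subseteq> F \<Longrightarrow> dist (sum f F) S < 1"
    by (auto simp: eventually_finite_subsets_at_top)
  have "norm (f k) \<le> 2 + (\<Sum>j\<in>X. norm (f j))" for k
  proof (cases "k \<in> X")
    case True
    then show ?thesis
      using member_le_sum [OF True, of "\<lambda>j. norm (f j)"] X by simp
  next
    case False
    have "f k = sum f (insert k X) - sum f X"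
      using False X by simp
    also have "norm \<dots> \<le> dist (sum f (insert k X)) S + dist (sum f X) S"
      by (metis dist_norm dist_triangle2)
    also have "\<dots> \<le> 2"
      using close [of "insert k X"] close [of X] X by (fastforce intro: less_imp_le)
    finally show ?thesis
      by (simp add: sum_nonneg add_increasing2)
  qed
  then show ?thesis
    by blast
qed

text \<open>The multi-indices with all entries at most \<open>N\<close>.\<close>

definition index_box :: "nat \<Rightarrow> ('n::finite \<Rightarrow> nat) set"
  where "index_box N = {k. \<forall>i. k i \<le> N}"

lemma index_box_eq_PiE: "index_box N = PiE UNIV (\<lambda>_. {..N})"
  by (auto simp: index_box_def)

lemma finite_index_box [simp]: "finite (index_box N)"
  unfolding index_box_eq_PiE by (intro finite_PiE) auto

lemma finite_subset_index_box:
  assumes "finite F"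
  shows "\<exists>N. F \<subseteq> (index_box N :: ('n::finite \<Rightarrow> nat) set)"
proof (intro exI subsetI)
  fix k assume "k \<in> F"
  have "k i \<le> (\<Sum>k\<in>F. \<Sum>i\<in>UNIV. k i)" for i
  proof -
    have "k i \<le> (\<Sum>i\<in>UNIV. k i)"
      by (rule member_le_sum) auto
    also have "\<dots> \<le> (\<Sum>k\<in>F. \<Sum>i\<in>UNIV. k i)"
      using \<open>k \<in> F\<close> assms by (intro member_le_sum [where f = "\<lambda>k. \<Sum>i\<in>UNIV. k i"]) auto
    finally show ?thesis .
  qed
  then show "k \<in> index_box (\<Sum>k\<in>F. \<Sum>i\<in>UNIV. k i)"
    by (simp add: index_box_def)
qed

lemma finite_atMost_multi_index [simp]: "finite {..k :: 'n::finite \<Rightarrow> nat}"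
proof -
  have "{..k} = PiE UNIV (\<lambda>i. {..k i})"
    by (auto simp: le_fun_def PiE_def Pi_def)
  then show ?thesis
    by (simp add: finite_PiE)
qed

lemma cmod_monomial: "cmod (monomial k z) = (\<Prod>i\<in>UNIV. cmod (z $ i) ^ k i)"
  by (simp add: monomial_def norm_power flip: prod_norm)

lemma monomial_mult_diff:
  assumes "j \<le> k"
  shows "monomial j z * monomial (k - j) z = monomial k z"
  using assms by (simp add: monomial_def le_fun_def flip: prod.distrib power_add)

lemma summable_multi_geometric:
  assumes "0 \<le> t" "t < (1::real)"
  shows "(\<lambda>k :: 'n::finite \<Rightarrow> nat. \<Prod>i\<in>UNIV. t ^ k i) summable_on UNIV"
proof (rule nonneg_bdd_above_summable_on)
  show "bdd_above (sum (\<lambda>k :: 'n \<Rightarrow> nat. \<Prod>i\<in>UNIV. t ^ k i) ` {F. F \<subseteq> UNIV \<and> finite F})"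
  proof (rule bdd_aboveI2)
    fix F :: "('n \<Rightarrow> nat) set" assume "F \<in> {F. F \<subseteq> UNIV \<and> finite F}"
    then obtain N where N: "F \<subseteq> index_box N"
      using finite_subset_index_box by blast
    have "(\<Sum>k\<in>F. \<Prod>i\<in>UNIV. t ^ k i) \<le> (\<Sum>k\<in>index_box N. \<Prod>i\<in>(UNIV :: 'n set). t ^ k i)"
      by (rule sum_mono2 [OF finite_index_box N]) (simp add: prod_nonneg assms)
    also have "\<dots> = (\<Prod>i\<in>(UNIV :: 'n set). \<Sum>j\<le>N. t ^ j)"
      unfolding index_box_eq_PiE by (subst prod_sum_PiE) auto
    also have "\<dots> \<le> (\<Prod>i\<in>(UNIV :: 'n set). 1 / (1 - t))"
    proof (intro prod_mono conjI)
      show "(\<Sum>j\<le>N. t ^ j) \<le> 1 / (1 - t)"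
        using sum_le_suminf [of "\<lambda>j. t ^ j" "{..N}"] assms
        by (simp add: suminf_geometric summable_geometric)
    qed (use assms in \<open>auto intro: sum_nonneg\<close>)
    finally show "(\<Sum>k\<in>F. \<Prod>i\<in>UNIV. t ^ k i) \<le> (\<Prod>i\<in>(UNIV :: 'n set). 1 / (1 - t))" .
  qed
qed (use assms in \<open>auto intro: prod_nonneg\<close>)

lemma polydisc_radius:
  assumes "z \<in> (polydisc :: (complex ^ 'n::finite) set)"
  shows "\<exists>s. 0 \<le> s \<and> s < 1 \<and> (\<forall>i. cmod (z $ i) \<le> s)"
proof (intro exI conjI allI)
  show "Max (range (\<lambda>i. cmod (z $ i))) < 1"
    using assms by (subst Max_less_iff) (auto simp: polydisc_def)
  show le: "cmod (z $ i) \<le> Max (range (\<lambda>i. cmod (z $ i)))" for i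
    by (rule Max_ge) auto
  show "0 \<le> Max (range (\<lambda>i. cmod (z $ i)))"
    using order_trans [OF norm_ge_zero le] .
qed

lemma bounded_coeffs_abs_summable:
  fixes a :: "('n::finite \<Rightarrow> nat) \<Rightarrow> 'a::complex_normed_vector"
  assumes r: "0 < r" "\<And>k. (\<Prod>i\<in>UNIV. r ^ k i) * norm (a k) \<le> M"
    and s: "0 \<le> s" "s < r" "\<And>i. cmod (z $ i) \<le> s"
  shows "(\<lambda>k. norm (monomial k z *\<^sub>C a k)) summable_on UNIV"
proof (rule Infinite_Sum.abs_summable_on_comparison_test')
  show "(\<lambda>k :: 'n \<Rightarrow> nat. M * (\<Prod>i\<in>UNIV. (s / r) ^ k i)) summable_on UNIV"
    using r s by (intro summable_on_cmult_right summable_multi_geometric) auto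
  fix k :: "'n \<Rightarrow> nat"
  have "norm (monomial k z *\<^sub>C a k) \<le> (\<Prod>i\<in>UNIV. s ^ k i) * norm (a k)"
    unfolding norm_scaleC cmod_monomial
    by (intro mult_right_mono prod_mono conjI power_mono s) auto
  also have "\<dots> = (\<Prod>i\<in>UNIV. (s / r) ^ k i) * ((\<Prod>i\<in>UNIV. r ^ k i) * norm (a k))"
    using r by (simp add: power_divide flip: prod.distrib)
  also have "\<dots> \<le> (\<Prod>i\<in>UNIV. (s / r) ^ k i) * M"
    using r s by (intro mult_left_mono prod_nonneg) auto
  finally show "norm (monomial k z *\<^sub>C a k) \<le> M * (\<Prod>i\<in>UNIV. (s / r) ^ k i)"
    by (simp add: mult.commute)
qed

text \<open>Unconditional convergence throughout the polydisc is automatically absolute, in any normed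
  space: compare with a geometric series at a larger radius.\<close>

lemma power_series_abs_summable:
  fixes f :: "complex ^ 'n::finite \<Rightarrow> 'a::complex_normed_vector"
  assumes "has_power_series f a" "z \<in> polydisc"
  shows "(\<lambda>k. norm (monomial k z *\<^sub>C a k)) summable_on UNIV"
proof -
  obtain s where "0 \<le> s \<and> s < 1 \<and> (\<forall>i. cmod (z $ i) \<le> s)"
    using polydisc_radius [OF assms(2)] ..
  then have s: "0 \<le> s" "s < 1" "\<And>i. cmod (z $ i) \<le> s"
    by simp_all
  define r where "r = (1 + s) / 2"
  have r: "0 < r" "s < r" "r < 1"
    using s by (auto simp: r_def)
  define w :: "complex ^ 'n" where "w = (\<chi> i. complex_of_real r)"
  have "w \<in> polydisc"
    using r by (simp add: polydisc_def w_def)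
  then obtain M where M: "\<And>k. norm (monomial k w *\<^sub>C a k) \<le> M"
    using assms(1) summable_on_imp_bounded_terms [OF has_sum_imp_summable]
    unfolding has_power_series_def by blast
  show ?thesis
    by (rule bounded_coeffs_abs_summable [OF r(1) _ s(1) r(2) s(3), of _ M])
      (use M r in \<open>simp add: norm_scaleC cmod_monomial w_def\<close>)
qed

lemma bounded_coeffs_imp_power_series:
  fixes a :: "('n::finite \<Rightarrow> nat) \<Rightarrow> 'a::{complex_normed_vector, banach}"
  assumes "\<And>k. norm (a k) \<le> M" "z \<in> polydisc"
  shows "((\<lambda>k. monomial k z *\<^sub>C a k) has_sum (\<Sum>\<^sub>\<infinity>k. monomial k z *\<^sub>C a k)) UNIV"
proof -
  obtain s where "0 \<le> s \<and> s < 1 \<and> (\<forall>i. cmod (z $ i) \<le> s)"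
    using polydisc_radius [OF assms(2)] ..
  then have s: "0 \<le> s" "s < 1" "\<And>i. cmod (z $ i) \<le> s"
    by simp_all
  show ?thesis
    by (rule has_sum_infsum, rule abs_summable_summable,
        rule bounded_coeffs_abs_summable [of 1 a M, OF _ _ s]) (use assms in auto)
qed

text \<open>Coefficients of the product of an operator-valued and a vector-valued power series.\<close>

definition cauchy_product ::
    "(('n::finite \<Rightarrow> nat) \<Rightarrow> 'a::complex_normed_vector \<Rightarrow>\<^sub>L 'b::complex_normed_vector) \<Rightarrow>
      (('n \<Rightarrow> nat) \<Rightarrow> 'a) \<Rightarrow> ('n \<Rightarrow> nat) \<Rightarrow> 'b"
  where "cauchy_product A a k = (\<Sum>j\<le>k. blinfun_apply (A j) (a (k - j)))"

lemma summable_on_product_nonneg: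
  fixes f :: "'i \<Rightarrow> real" and g :: "'j \<Rightarrow> real"
  assumes "f summable_on UNIV" "g summable_on UNIV" "\<And>i. 0 \<le> f i" "\<And>j. 0 \<le> g j"
  shows "(\<lambda>(i, j). f i * g j) summable_on UNIV \<times> UNIV"
proof (rule nonneg_bdd_above_summable_on)
  show "bdd_above (sum (\<lambda>(i, j). f i * g j) ` {F. F \<subseteq> UNIV \<times> UNIV \<and> finite F})"
  proof (rule bdd_aboveI2)
    fix F :: "('i \<times> 'j) set" assume "F \<in> {F. F \<subseteq> UNIV \<times> UNIV \<and> finite F}"
    then have F: "finite F" by simp
    have "(\<Sum>(i, j)\<in>F. f i * g j) \<le> (\<Sum>(i, j)\<in>fst ` F \<times> snd ` F. f i * g j)"
      using F assms by (intro sum_mono2 subset_fst_snd) auto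
    also have "\<dots> = (\<Sum>i\<in>fst ` F. f i) * (\<Sum>j\<in>snd ` F. g j)"
      by (simp add: sum_product sum.cartesian_product)
    also have "\<dots> \<le> infsum f UNIV * infsum g UNIV"
      using F assms
      by (intro mult_mono finite_sum_le_infsum sum_nonneg infsum_nonneg) auto
    finally show "(\<Sum>(i, j)\<in>F. f i * g j) \<le> infsum f UNIV * infsum g UNIV" .
  qed
qed (use assms in auto)

lemma has_power_series_product:
  fixes \<Theta> :: "complex ^ 'n::finite \<Rightarrow> 'a::complex_normed_vector \<Rightarrow>\<^sub>L 'b::{complex_normed_vector, banach}"
  assumes \<Theta>: "has_power_series \<Theta> A" and A: "\<And>k. A k \<in> bounded_ops"
    and h: "has_power_series h a"
  shows "has_power_series (\<lambda>z. blinfun_apply (\<Theta> z) (h z)) (cauchy_product A a)"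
  unfolding has_power_series_def
proof
  fix z :: "complex ^ 'n" assume z: "z \<in> polydisc"
  define g where "g = (\<lambda>(j, l). blinfun_apply (monomial j z *\<^sub>C A j) (monomial l z *\<^sub>C a l))"
  have "(\<lambda>(j, l). norm (monomial j z *\<^sub>C A j) * norm (monomial l z *\<^sub>C a l)) summable_on UNIV \<times> UNIV"
    by (intro summable_on_product_nonneg power_series_abs_summable [OF \<Theta> z]
        power_series_abs_summable [OF h z]) auto
  then have "(\<lambda>p. norm (g p)) summable_on UNIV \<times> UNIV"
    by (rule Infinite_Sum.abs_summable_on_comparison_test') (auto simp: g_def norm_blinfun)
  then have "g summable_on UNIV \<times> UNIV"
    by (rule abs_summable_summable)
  then have g: "(g has_sum infsum g (UNIV \<times> UNIV)) (UNIV \<times> UNIV)"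
    by (rule has_sum_infsum)
  have hz: "((\<lambda>l. monomial l z *\<^sub>C a l) has_sum h z) UNIV"
    and \<Theta>z: "((\<lambda>j. monomial j z *\<^sub>C A j) has_sum \<Theta> z) UNIV"
    using h \<Theta> z by (auto simp: has_power_series_def)
  have "((\<lambda>j. blinfun_apply (monomial j z *\<^sub>C A j) (h z)) has_sum infsum g (UNIV \<times> UNIV)) UNIV"
  proof (rule has_sum_SigmaD [OF g])
    fix j
    show "((\<lambda>l. g (j, l)) has_sum blinfun_apply (monomial j z *\<^sub>C A j) (h z)) UNIV"
      unfolding g_def split by (intro has_sum_bounded_linear [OF _ hz] blinfun.bounded_linear_right)
  qed
  moreover have "((\<lambda>j. blinfun_apply (monomial j z *\<^sub>C A j) (h z)) has_sum blinfun_apply (\<Theta> z) (h z)) UNIV"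
    by (intro has_sum_bounded_linear [OF _ \<Theta>z] blinfun.bounded_linear_left)
  ultimately have S: "infsum g (UNIV \<times> UNIV) = blinfun_apply (\<Theta> z) (h z)"
    by (rule has_sum_unique)
  \<comment> \<open>the same double series, summed along the antidiagonals\<close>
  define \<phi> :: "('n \<Rightarrow> nat) \<times> ('n \<Rightarrow> nat) \<Rightarrow> ('n \<Rightarrow> nat) \<times> ('n \<Rightarrow> nat)"
    where "\<phi> = (\<lambda>(k, j). (j, k - j))"
  have "bij_betw \<phi> (SIGMA k:UNIV. {..k}) (UNIV \<times> UNIV)"
    by (rule bij_betw_byWitness [where f' = "\<lambda>(j, l). (\<lambda>i. l i + j i, j)"])
      (auto simp: \<phi>_def le_fun_def fun_eq_iff)
  then have "((\<lambda>p. g (\<phi> p)) has_sum blinfun_apply (\<Theta> z) (h z)) (SIGMA k:UNIV. {..k})"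
    using g unfolding S by (simp add: has_sum_reindex_bij_betw)
  then have "((\<lambda>(k, j). g (j, k - j)) has_sum blinfun_apply (\<Theta> z) (h z)) (SIGMA k:UNIV. {..k})"
    by (simp add: \<phi>_def case_prod_unfold)
  then show "((\<lambda>k. monomial k z *\<^sub>C cauchy_product A a k) has_sum blinfun_apply (\<Theta> z) (h z)) UNIV"
  proof (rule has_sum_SigmaD)
    fix k :: "'n \<Rightarrow> nat"
    have "g (j, k - j) = monomial k z *\<^sub>C blinfun_apply (A j) (a (k - j))" if "j \<le> k" for j
      using A monomial_mult_diff [OF that, of z]
      by (auto simp: g_def blinfun_apply_scaleC bounded_ops_def scaleC_scaleC)
    then have "(\<Sum>j\<le>k. g (j, k - j)) = monomial k z *\<^sub>C cauchy_product A a k"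
      by (simp add: cauchy_product_def complex_vector.scale_sum_right)
    then show "((\<lambda>j. case (k, j) of (k, j) \<Rightarrow> g (j, k - j)) has_sum monomial k z *\<^sub>C cauchy_product A a k) {..k}"
      by (intro has_sum_finiteI) auto
  qed
qed

text \<open>The Hardy space function with given Taylor coefficients, extended by \<open>0\<close> to all of \<open>\<complex>\<^sup>n\<close>.\<close>

definition hardy_of :: "('n::finite \<Rightarrow> nat, 'a::chilbert_space) ell2 \<Rightarrow> complex ^ 'n \<Rightarrow> 'a"
  where "hardy_of c z = (if z \<in> polydisc then \<Sum>\<^sub>\<infinity>k. monomial k z *\<^sub>C entry c k else 0)"

lemma hardy_of_power_series: "has_power_series (hardy_of c) (entry c)"
  unfolding has_power_series_def hardy_of_def
  using bounded_coeffs_imp_power_series [of "entry c" "norm c"] by (auto simp: norm_entry_le)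

lemma hardy_of_in_hardy_space: "hardy_of c \<in> hardy_space"
  using hardy_of_power_series [of c] sq_summable_entry [of c]
  by (auto simp: hardy_space_def hardy_of_def)

lemma hardy_space_eq_hardy_of:
  assumes "f \<in> hardy_space"
  obtains c where "f = hardy_of c"
proof -
  obtain a where a: "has_power_series f a" "(\<lambda>k. (norm (a k))\<^sup>2) summable_on UNIV"
    and out: "\<And>z. z \<notin> polydisc \<Longrightarrow> f z = 0"
    using assms by (auto simp: hardy_space_def)
  have "entry (Abs_ell2 a) = a"
    using a(2) by (intro Abs_ell2_inverse) simp
  then have "f = hardy_of (Abs_ell2 a)"
    using a(1) out by (auto simp: hardy_of_def fun_eq_iff has_power_series_def infsumI)
  then show ?thesis
    by (rule that)
qed

lemma hardy_of_add: "hardy_of (c + d) = hardy_of c + hardy_of d"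
proof
  fix z :: "complex ^ 'a"
  show "hardy_of (c + d) z = (hardy_of c + hardy_of d) z"
  proof (cases "z \<in> polydisc")
    case True
    have "((\<lambda>k. monomial k z *\<^sub>C entry c k + monomial k z *\<^sub>C entry d k) has_sum
        (hardy_of c z + hardy_of d z)) UNIV"
      using hardy_of_power_series [of c] hardy_of_power_series [of d] True
      by (intro has_sum_add) (auto simp: has_power_series_def)
    then show ?thesis
      using True by (simp add: hardy_of_def entry_add scaleC_add_right infsumI)
  qed (simp add: hardy_of_def)
qed

lemma hardy_of_scaleC: "hardy_of (b *\<^sub>C c) = b *\<^sub>C hardy_of c"
proof
  fix z :: "complex ^ 'a"
  show "hardy_of (b *\<^sub>C c) z = (b *\<^sub>C hardy_of c) z"
  proof (cases "z \<in> polydisc")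
    case True
    have "((\<lambda>k. b *\<^sub>C monomial k z *\<^sub>C entry c k) has_sum b *\<^sub>C hardy_of c z) UNIV"
      using hardy_of_power_series [of c] True
      by (intro has_sum_bounded_linear [OF bounded_linear_scaleC]) (auto simp: has_power_series_def)
    then show ?thesis
      using True by (simp add: hardy_of_def entry_scaleC scaleC_fun_def scaleC_scaleC mult.commute infsumI)
  qed (simp add: hardy_of_def scaleC_fun_def)
qed

lemma hardy_of_zero [simp]: "hardy_of 0 = 0"
  using hardy_of_scaleC [of 0 0] by (simp add: fun_eq_iff scaleC_fun_def)

lemma hardy_of_sum: "hardy_of (\<Sum>i\<in>I. c i) = (\<Sum>i\<in>I. hardy_of (c i))"
  by (induction I rule: infinite_finite_induct) (auto simp: hardy_of_add)


section \<open>Parseval's identity on the torus\<close>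

text \<open>The torus is parametrised by angles; \<^term>\<open>torus_measure\<close> is the image of the normalised
  Lebesgue measure on the cube of angles.\<close>

definition angle_measure :: "(real ^ 'n::finite) measure"
  where "angle_measure = uniform_measure lborel (cbox 0 (\<chi> i. 2 * pi))"

definition torus_point :: "real ^ 'n::finite \<Rightarrow> complex ^ 'n"
  where "torus_point t = (\<chi> i. cis (t $ i))"

lemma torus_measure_eq: "torus_measure = distr angle_measure borel torus_point"
  by (simp add: torus_measure_def angle_measure_def torus_point_def [abs_def])

lemma sets_angle_measure [measurable_cong, simp]: "sets angle_measure = sets borel"
  by (simp add: angle_measure_def)

lemma space_angle_measure [simp]: "space angle_measure = UNIV"
  by (simp add: angle_measure_def)

lemma continuous_torus_point: "continuous_on UNIV (torus_point :: real ^ 'n::finite \<Rightarrow> _)"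
proof -
  have "continuous_on UNIV (\<lambda>t :: real ^ 'n. \<chi> i. exp (\<i> * complex_of_real (t $ i)))"
    by (intro continuous_intros)
  then show ?thesis
    by (simp add: torus_point_def [abs_def] cis_conv_exp)
qed

lemma measurable_torus_point: "torus_point \<in> borel_measurable angle_measure"
  using borel_measurable_continuous_onI [OF continuous_torus_point]
  by (simp add: measurable_cong_sets [OF sets_angle_measure refl])

lemma emeasure_angle_cube:
  "emeasure lborel (cbox 0 (\<chi> i. 2 * pi) :: (real ^ 'n::finite) set) = ennreal ((2 * pi) ^ CARD('n))"
proof -
  have "b \<bullet> (\<chi> i. 2 * pi) = 2 * pi" if "b \<in> Basis" for b :: "real ^ 'n"
    using that by (auto simp: Basis_vec_def inner_axis')
  then have b: "(\<chi> i. 2 * pi) \<bullet> b = 2 * pi" if "b \<in> Basis" for b :: "real ^ 'n"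
    using that by (simp add: inner_commute)
  have "(\<Prod>b\<in>(Basis :: (real ^ 'n) set). ((\<chi> i. 2 * pi) - 0) \<bullet> b) = (2 * pi) ^ CARD('n)"
    by (simp add: b)
  then show ?thesis
    by (subst emeasure_lborel_cbox_eq) (simp add: b)
qed

lemma finite_measure_angle: "finite_measure (angle_measure :: (real ^ 'n::finite) measure)"
proof
  have "emeasure (angle_measure :: (real ^ 'n) measure) (cbox 0 (\<chi> i. 2 * pi) \<union> UNIV) = 1"
    unfolding angle_measure_def
    by (subst emeasure_uniform_measure) (auto simp: emeasure_angle_cube ennreal_divide_self)
  then show "emeasure (angle_measure :: (real ^ 'n) measure) (space angle_measure) \<noteq> \<infinity>"
    by simp
qed

lemma integral_angle_measure:
  fixes f :: "real ^ 'n::finite \<Rightarrow> complex"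
  assumes [measurable]: "f \<in> borel_measurable borel"
  shows "integral\<^sup>L angle_measure f =
    (\<integral>t. (indicator (cbox 0 (\<chi> i. 2 * pi)) t / (2 * pi) ^ CARD('n)) *\<^sub>R f t \<partial>lborel)"
proof -
  have eq: "angle_measure = density lborel (\<lambda>t :: real ^ 'n.
      ennreal (indicator (cbox 0 (\<chi> i. 2 * pi)) t / (2 * pi) ^ CARD('n)))"
    unfolding angle_measure_def uniform_measure_def emeasure_angle_cube
    by (intro arg_cong [where f = "density lborel"] ext)
      (auto simp: indicator_def divide_ennreal [symmetric] ennreal_1 [symmetric] simp del: ennreal_1)
  show ?thesis
    unfolding eq by (rule integral_density) simp_all
qed

lemma integral_circle_character:
  "(\<integral>s. (indicator {0..2 * pi} s / (2 * pi)) *\<^sub>R cis (of_int m * s) \<partial>lborel) = (if m = 0 then 1 else 0)"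
proof (cases "m = 0")
  case True
  have "(\<integral>s. indicator {0..2 * pi} s *\<^sub>R (1 / (2 * complex_of_real pi)) \<partial>lborel) =
      (2 * pi) *\<^sub>R (1 / (2 * complex_of_real pi)) - 0 *\<^sub>R (1 / (2 * complex_of_real pi))"
    by (rule integral_FTC_atLeastAtMost) (auto intro!: derivative_eq_intros continuous_intros)
  also have "\<dots> = 1"
    by (simp add: scaleR_conv_of_real)
  finally show ?thesis
    using True by (simp add: scaleR_conv_of_real)
next
  case False
  define F where "F = (\<lambda>s. exp (\<i> * of_int m * complex_of_real s) / (2 * pi * \<i> * of_int m))"
  have "(\<integral>s. indicator {0..2 * pi} s *\<^sub>R (exp (\<i> * of_int m * complex_of_real s) / (2 * pi)) \<partial>lborel) =
      F (2 * pi) - F 0"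
  proof (rule integral_FTC_atLeastAtMost)
    fix s
    have "((\<lambda>z. exp (\<i> * of_int m * z) / (2 * pi * \<i> * of_int m)) has_field_derivative
        exp (\<i> * of_int m * complex_of_real s) / (2 * pi)) (at (complex_of_real s))"
      using False by (auto intro!: derivative_eq_intros simp: field_simps)
    from has_vector_derivative_real_field [OF this]
    show "(F has_vector_derivative exp (\<i> * of_int m * complex_of_real s) / (2 * pi))
        (at s within {0..2 * pi})"
      unfolding F_def by (simp add: o_def)
  qed (auto intro!: continuous_intros)
  also have "F (2 * pi) - F 0 = 0"
    using exp_integer_2pi [of "of_int m"] by (simp add: F_def mult_ac)
  finally show ?thesis
    using False by (simp add: cis_conv_exp scaleR_conv_of_real mult_ac)
qed

lemma integral_torus_character:
  fixes m :: "'n::finite \<Rightarrow> int"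
  shows "(\<integral>t. (\<Prod>i\<in>UNIV. cis (of_int (m i) * t $ i)) \<partial>angle_measure) = (if m = (\<lambda>_. 0) then 1 else 0)"
proof -
  define \<phi> where "\<phi> = (\<lambda>(i :: 'n) s. (indicator {0..2 * pi} s / (2 * pi)) *\<^sub>R cis (of_int (m i) * s))"
  define \<psi> where "\<psi> = (\<lambda>b :: real ^ 'n. \<phi> (THE i. b = axis i 1))"
  have \<psi>: "\<psi> (axis i 1) = \<phi> i" for i
    unfolding \<psi>_def by (rule arg_cong [where f = \<phi>]) (auto simp: axis_eq_axis)
  have Basis: "(Basis :: (real ^ 'n) set) = (\<lambda>i. axis i 1) ` UNIV"
    by (auto simp: Basis_vec_def)
  have inj: "inj (\<lambda>i :: 'n. axis i (1 :: real))"
    by (auto simp: inj_on_def axis_eq_axis)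
  have prod_Basis: "(\<Prod>b\<in>Basis. g b) = (\<Prod>i\<in>UNIV. g (axis i 1))" for g :: "real ^ 'n \<Rightarrow> complex"
    unfolding Basis by (subst prod.reindex [OF inj]) simp
  have cube: "indicator (cbox 0 (\<chi> i. 2 * pi)) t = (\<Prod>i\<in>UNIV. indicator {0..2 * pi} (t $ i) :: real)"
    for t :: "real ^ 'n"
    by (cases "\<forall>i. 0 \<le> t $ i \<and> t $ i \<le> 2 * pi")
      (auto simp: indicator_def mem_box_cart prod_zero_iff)
  have cis_measurable: "(\<lambda>s. cis (of_int m * s)) \<in> borel_measurable borel" for m
    unfolding cis_conv_exp by (intro borel_measurable_continuous_onI continuous_intros)
  have \<phi>_int: "integrable lborel (\<phi> i)" for i
  proof -
    have "set_integrable lborel {0..2 * pi} (\<lambda>s. cis (of_int (m i) * s) / (2 * pi))"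
      unfolding cis_conv_exp by (intro borel_integrable_atLeastAtMost' continuous_intros) auto
    then show ?thesis
      unfolding set_integrable_def \<phi>_def by (simp add: scaleR_conv_of_real)
  qed
  then have \<psi>_int: "integrable lborel (\<psi> b)" if "b \<in> Basis" for b
    using that by (auto simp: Basis \<psi>)
  have \<psi>_measurable: "\<psi> b \<in> borel_measurable lborel" if "b \<in> Basis" for b
    using \<psi>_int [OF that] by (rule borel_measurable_integrable)
  have prod_measurable: "(\<lambda>t. \<Prod>b\<in>Basis. \<psi> b (t \<bullet> b)) \<in> borel_measurable borel"
  proof (rule borel_measurable_prod)
    fix b :: "real ^ 'n" assume "b \<in> Basis"
    show "(\<lambda>t. \<psi> b (t \<bullet> b)) \<in> borel_measurable borel"
      by (rule measurable_compose [of "\<lambda>t. t \<bullet> b" borel borel])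
        (use \<psi>_measurable [OF \<open>b \<in> Basis\<close>] in auto)
  qed
  interpret product_sigma_finite "\<lambda>_ :: real ^ 'n. lborel :: real measure"
    by standard
  have "(\<integral>t. (\<Prod>i\<in>UNIV. cis (of_int (m i) * t $ i)) \<partial>angle_measure) =
      (\<integral>t. (indicator (cbox 0 (\<chi> i. 2 * pi)) t / (2 * pi) ^ CARD('n)) *\<^sub>R
        (\<Prod>i\<in>UNIV. cis (of_int (m i) * t $ i)) \<partial>lborel)"
    unfolding cis_conv_exp
    by (intro integral_angle_measure borel_measurable_continuous_onI continuous_intros)
  also have "\<dots> = (\<integral>t. (\<Prod>b\<in>Basis. \<psi> b (t \<bullet> b)) \<partial>(lborel :: (real ^ 'n) measure))"
  proof (rule Bochner_Integration.integral_cong [OF refl])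
    fix t :: "real ^ 'n"
    have component: "t \<bullet> axis i 1 = t $ i" for i
      by (simp add: inner_axis)
    have "(indicator (cbox 0 (\<chi> i. 2 * pi)) t / (2 * pi) ^ CARD('n) :: real) =
        (\<Prod>i\<in>UNIV. indicator {0..2 * pi} (t $ i) / (2 * pi))"
      unfolding cube by (simp add: prod_dividef)
    moreover have "(\<Prod>b\<in>Basis. \<psi> b (t \<bullet> b)) =
        (\<Prod>i\<in>UNIV. complex_of_real (indicator {0..2 * pi} (t $ i) / (2 * pi)) * cis (of_int (m i) * t $ i))"
      unfolding prod_Basis \<psi> component \<phi>_def scaleR_conv_of_real ..
    ultimately show "(indicator (cbox 0 (\<chi> i. 2 * pi)) t / (2 * pi) ^ CARD('n)) *\<^sub>R
        (\<Prod>i\<in>UNIV. cis (of_int (m i) * t $ i)) = (\<Prod>b\<in>Basis. \<psi> b (t \<bullet> b))"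
      unfolding prod.distrib by (simp only: scaleR_conv_of_real of_real_prod)
  qed
  also have "\<dots> = (\<integral>f. (\<Prod>b\<in>Basis. \<psi> b ((\<Sum>c\<in>Basis. f c *\<^sub>R c) \<bullet> b)) \<partial>(\<Pi>\<^sub>M b\<in>(Basis :: (real ^ 'n) set). lborel))"
    by (subst lborel_eq, rule integral_distr) (use prod_measurable in auto)
  also have "\<dots> = (\<integral>f. (\<Prod>b\<in>Basis. \<psi> b (f b)) \<partial>(\<Pi>\<^sub>M b\<in>(Basis :: (real ^ 'n) set). lborel))"
    by (intro Bochner_Integration.integral_cong refl prod.cong)
      (simp add: inner_sum_left inner_Basis if_distrib cong: if_cong)
  also have "\<dots> = (\<Prod>b\<in>Basis. integral\<^sup>L lborel (\<psi> b))"
    by (intro product_integral_prod \<psi>_int) auto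
  also have "\<dots> = (\<Prod>i\<in>UNIV. if m i = 0 then 1 else 0)"
    unfolding prod_Basis by (simp only: \<psi> \<phi>_def integral_circle_character)
  also have "\<dots> = (if m = (\<lambda>_. 0) then 1 else 0)"
    by (auto simp: fun_eq_iff prod_zero_iff)
  finally show ?thesis .
qed

lemma continuous_monomial_torus: "continuous_on UNIV (\<lambda>t. monomial k (torus_point t))"
  unfolding monomial_def torus_point_def by (simp add: cis_conv_exp) (intro continuous_intros)

lemma cmod_monomial_torus [simp]: "cmod (monomial k (torus_point t)) = 1"
  by (simp add: cmod_monomial torus_point_def)

lemma integral_monomial_orthonormal:
  "(\<integral>t. monomial k (torus_point t) * cnj (monomial l (torus_point t)) \<partial>angle_measure) =
    (if k = l then 1 else 0)"
proof -
  have "monomial k (torus_point t) * cnj (monomial l (torus_point t)) =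
      (\<Prod>i\<in>UNIV. cis (of_int (int (k i) - int (l i)) * t $ i))" for t
    unfolding monomial_def torus_point_def cnj_prod prod.distrib [symmetric]
    by (rule prod.cong) (simp_all add: Complex.DeMoivre cis_cnj cis_mult algebra_simps del: complex_cnj_power)
  then show ?thesis
    using integral_torus_character [of "\<lambda>i. int (k i) - int (l i)"] by (simp only:) (auto simp: fun_eq_iff)
qed

lemma integrable_angle_continuous:
  fixes f :: "real ^ 'n::finite \<Rightarrow> 'a::{banach, second_countable_topology}"
  assumes "continuous_on UNIV f" "\<And>t. norm (f t) \<le> B"
  shows "integrable angle_measure f"
proof -
  interpret finite_measure "angle_measure :: (real ^ 'n) measure"
    by (rule finite_measure_angle)
  show ?thesis
    using borel_measurable_continuous_onI [OF assms(1)] assms(2)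
    by (intro integrable_const_bound [of _ B])
      (auto simp: measurable_cong_sets [OF sets_angle_measure refl])
qed

lemma parseval_finite:
  fixes b :: "('n::finite \<Rightarrow> nat) \<Rightarrow> 'a::complex_inner"
  assumes "finite F"
  shows "(\<integral>t. (norm (\<Sum>k\<in>F. monomial k (torus_point t) *\<^sub>C b k))\<^sup>2 \<partial>angle_measure) = (\<Sum>k\<in>F. (norm (b k))\<^sup>2)"
proof -
  have cont: "continuous_on UNIV (\<lambda>t. monomial k (torus_point t) * cnj (monomial l (torus_point t)))"
    for k l :: "'n \<Rightarrow> nat"
    by (intro continuous_intros continuous_monomial_torus)
  then have int: "integrable angle_measure (\<lambda>t. monomial k (torus_point t) * cnj (monomial l (torus_point t)))"
    for k l :: "'n \<Rightarrow> nat"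
    by (rule integrable_angle_continuous [where B = 1]) (simp add: norm_mult)
  have "complex_of_real (\<integral>t. (norm (\<Sum>k\<in>F. monomial k (torus_point t) *\<^sub>C b k))\<^sup>2 \<partial>angle_measure) =
      (\<integral>t. (\<Sum>k\<in>F. \<Sum>l\<in>F. monomial k (torus_point t) * cnj (monomial l (torus_point t)) * cinner (b k) (b l)) \<partial>angle_measure)"
    unfolding integral_complex_of_real [symmetric]
    by (intro Bochner_Integration.integral_cong refl)
      (simp add: cinner_norm [symmetric] cinner_sum_left cinner_sum_right cinner_scaleC_left
        cinner_scaleC_right sum_distrib_left mult_ac del: of_real_power, rule sum.swap)
  also have "\<dots> = (\<Sum>k\<in>F. \<Sum>l\<in>F. (if k = l then 1 else 0) * cinner (b k) (b l))"
    by (simp add: int Bochner_Integration.integral_sum integral_monomial_orthonormal)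
  also have "\<dots> = (\<Sum>k\<in>F. cinner (b k) (b k))"
    using assms by (intro sum.cong refl) (simp add: if_distrib [of "\<lambda>x. x * _"] cong: if_cong)
  also have "\<dots> = complex_of_real (\<Sum>k\<in>F. (norm (b k))\<^sup>2)"
    by (simp add: cinner_norm)
  finally show ?thesis
    using of_real_eq_iff by blast
qed

lemma continuous_torus_polynomial:
  fixes b :: "('n::finite \<Rightarrow> nat) \<Rightarrow> 'a::complex_normed_vector"
  shows "continuous_on UNIV (\<lambda>t. \<Sum>k\<in>F. monomial k (torus_point t) *\<^sub>C b k)"
proof (rule continuous_on_sum)
  fix k
  have "bounded_linear (\<lambda>c. c *\<^sub>C b k)"
    by (rule bounded_linear_intro [where K = "norm (b k)"])
      (auto simp: scaleC_add_left scaleR_scaleC [where 'a = 'a] scaleC_scaleC scaleR_conv_of_real norm_scaleC)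
  then show "continuous_on UNIV (\<lambda>t. monomial k (torus_point t) *\<^sub>C b k)"
    by (rule bounded_linear.continuous_on [OF _ continuous_monomial_torus])
qed

lemma has_sum_imp_index_box_tendsto:
  fixes f :: "('n::finite \<Rightarrow> nat) \<Rightarrow> 'a::topological_comm_monoid_add"
  assumes "(f has_sum S) UNIV"
  shows "(\<lambda>N. sum f (index_box N)) \<longlonglongrightarrow> S"
proof -
  have "filterlim index_box (finite_subsets_at_top (UNIV :: ('n \<Rightarrow> nat) set)) sequentially"
    unfolding filterlim_finite_subsets_at_top
  proof (intro allI impI, elim conjE)
    fix X :: "('n \<Rightarrow> nat) set" assume "finite X"
    then obtain N where "X \<subseteq> index_box N"
      using finite_subset_index_box by blast
    moreover have "index_box N \<subseteq> (index_box M :: ('n \<Rightarrow> nat) set)" if "M \<ge> N" for M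
      unfolding index_box_def using that le_trans by blast
    ultimately have "X \<subseteq> index_box M" if "M \<ge> N" for M
      using that by blast
    then show "\<forall>\<^sub>F N in sequentially. finite (index_box N) \<and> X \<subseteq> index_box N \<and> index_box N \<subseteq> UNIV"
      by (auto simp: eventually_sequentially)
  qed
  with assms show ?thesis
    unfolding has_sum_def by (rule filterlim_compose)
qed

lemma scaleR_torus_point_in_polydisc:
  "0 < r \<Longrightarrow> r < 1 \<Longrightarrow> r *\<^sub>R torus_point t \<in> polydisc"
  by (simp add: polydisc_def torus_point_def)

lemma monomial_scaleR:
  "monomial k (r *\<^sub>R z) = complex_of_real (\<Prod>i\<in>UNIV. r ^ k i) * monomial k z"
  unfolding monomial_def vector_scaleR_component scaleR_conv_of_real [where 'a = complex]
  by (simp add: power_mult_distrib prod.distrib)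

text \<open>The partial sums over index boxes are uniformly bounded on the torus of radius \<open>r\<close>, so the
  identity for finite sums passes to the limit by dominated convergence.\<close>

lemma parseval:
  fixes f :: "complex ^ 'n::finite \<Rightarrow> 'a::chilbert_space"
  assumes f: "has_power_series f a" and r: "0 < r" "r < 1"
  shows "(\<lambda>t. (norm (f (r *\<^sub>R torus_point t)))\<^sup>2) \<in> borel_measurable angle_measure"
    and "((\<lambda>k. (\<Prod>i\<in>UNIV. r ^ k i)\<^sup>2 * (norm (a k))\<^sup>2) has_sum
      (\<integral>t. (norm (f (r *\<^sub>R torus_point t)))\<^sup>2 \<partial>angle_measure)) UNIV"
proof -
  interpret finite_measure "angle_measure :: (real ^ 'n) measure"
    by (rule finite_measure_angle)
  define b where "b = (\<lambda>k. complex_of_real (\<Prod>i\<in>UNIV. r ^ k i) *\<^sub>C a k)"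
  define P where "P = (\<lambda>N t. \<Sum>k\<in>index_box N. monomial k (torus_point t) *\<^sub>C b k)"
  have b: "monomial k (torus_point t) *\<^sub>C b k = monomial k (r *\<^sub>R torus_point t) *\<^sub>C a k" for k t
    by (simp add: b_def monomial_scaleR scaleC_scaleC mult.commute)
  have b_sq: "(norm (b k))\<^sup>2 = (\<Prod>i\<in>UNIV. r ^ k i)\<^sup>2 * (norm (a k))\<^sup>2" for k
    by (simp add: b_def norm_scaleC power_mult_distrib del: of_real_prod)
  have norm_b: "norm (b k) = norm (monomial k (r *\<^sub>R torus_point 0) *\<^sub>C a k)" for k
    by (simp add: norm_scaleC flip: b)
  have b_summable: "(\<lambda>k. norm (b k)) summable_on UNIV"
    unfolding norm_b by (intro power_series_abs_summable [OF f] scaleR_torus_point_in_polydisc r)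
  define G where "G = (\<Sum>\<^sub>\<infinity>k. norm (b k))"
  have sum_b: "(\<Sum>k\<in>F. norm (b k)) \<le> G" if "finite F" for F
    unfolding G_def using that b_summable by (intro finite_sum_le_infsum) auto
  have b_le: "norm (b k) \<le> G" for k
    using sum_b [of "{k}"] by simp
  have G: "0 \<le> G"
    using order_trans [OF norm_ge_zero b_le] .
  have P_bound: "norm (P N t) \<le> G" for N t
  proof -
    have "norm (P N t) \<le> (\<Sum>k\<in>index_box N. norm (b k))"
      unfolding P_def by (rule sum_norm_le) (simp add: norm_scaleC)
    also have "\<dots> \<le> G"
      by (intro sum_b) simp
    finally show ?thesis .
  qed
  have P_lim: "(\<lambda>N. (norm (P N t))\<^sup>2) \<longlonglongrightarrow> (norm (f (r *\<^sub>R torus_point t)))\<^sup>2" for t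
    unfolding P_def b using f scaleR_torus_point_in_polydisc [OF r]
    by (intro tendsto_intros has_sum_imp_index_box_tendsto) (auto simp: has_power_series_def)
  have P_cont: "continuous_on UNIV (\<lambda>t. (norm (P N t))\<^sup>2)" for N
    unfolding P_def by (intro continuous_intros continuous_torus_polynomial)
  have P_measurable: "(\<lambda>t. (norm (P N t))\<^sup>2) \<in> borel_measurable angle_measure" for N
    using borel_measurable_continuous_onI [OF P_cont]
    by (simp add: measurable_cong_sets [OF sets_angle_measure refl])
  show measurable: "(\<lambda>t. (norm (f (r *\<^sub>R torus_point t)))\<^sup>2) \<in> borel_measurable angle_measure"
    by (rule borel_measurable_LIMSEQ_real [OF P_lim P_measurable])
  have "(\<lambda>N. \<integral>t. (norm (P N t))\<^sup>2 \<partial>angle_measure) \<longlonglongrightarrow>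
      (\<integral>t. (norm (f (r *\<^sub>R torus_point t)))\<^sup>2 \<partial>angle_measure)"
  proof (rule integral_dominated_convergence [where w = "\<lambda>_. G\<^sup>2"])
    show "AE t in angle_measure. norm ((norm (P N t))\<^sup>2) \<le> G\<^sup>2" for N
      using P_bound by (simp add: power_mono)
  qed (use measurable P_measurable P_lim in auto)
  then have lim: "(\<lambda>N. \<Sum>k\<in>index_box N. (norm (b k))\<^sup>2) \<longlonglongrightarrow>
      (\<integral>t. (norm (f (r *\<^sub>R torus_point t)))\<^sup>2 \<partial>angle_measure)"
    unfolding P_def by (simp add: parseval_finite)
  have "(\<lambda>k. (norm (b k))\<^sup>2) summable_on UNIV"
  proof (rule sq_summableI)
    fix F :: "('n \<Rightarrow> nat) set" assume "finite F"
    have "(\<Sum>k\<in>F. (norm (b k))\<^sup>2) \<le> (\<Sum>k\<in>F. G * norm (b k))"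
      unfolding power2_eq_square by (intro sum_mono mult_right_mono b_le) auto
    also have "\<dots> \<le> G * G"
      unfolding sum_distrib_left [symmetric] by (intro mult_left_mono sum_b \<open>finite F\<close> G)
    finally show "(\<Sum>k\<in>F. (norm (b k))\<^sup>2) \<le> G * G" .
  qed
  then have sum: "((\<lambda>k. (norm (b k))\<^sup>2) has_sum (\<Sum>\<^sub>\<infinity>k. (norm (b k))\<^sup>2)) UNIV"
    by (rule has_sum_infsum)
  with LIMSEQ_unique [OF lim has_sum_imp_index_box_tendsto [OF sum]]
  show "((\<lambda>k. (\<Prod>i\<in>UNIV. r ^ k i)\<^sup>2 * (norm (a k))\<^sup>2) has_sum
      (\<integral>t. (norm (f (r *\<^sub>R torus_point t)))\<^sup>2 \<partial>angle_measure)) UNIV"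
    by (simp add: b_sq)
qed

lemma power_series_unique:
  fixes f :: "complex ^ 'n::finite \<Rightarrow> 'a::chilbert_space"
  assumes "has_power_series f a" "has_power_series f b"
  shows "a = b"
proof
  fix k
  have "has_power_series (\<lambda>z. f z - f z) (\<lambda>k. a k - b k)"
    unfolding has_power_series_def
  proof
    fix z :: "complex ^ 'n" assume "z \<in> polydisc"
    then have "((\<lambda>k. monomial k z *\<^sub>C a k + - (monomial k z *\<^sub>C b k)) has_sum (f z + - f z)) UNIV"
      using assms by (intro has_sum_add) (auto simp: has_power_series_def has_sum_uminus)
    then show "((\<lambda>k. monomial k z *\<^sub>C (a k - b k)) has_sum (f z - f z)) UNIV"
      by (simp add: complex_vector.scale_right_diff_distrib)
  qed
  from parseval(2) [OF this, of "1/2"]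
  have "((\<lambda>k. (\<Prod>i\<in>UNIV. (1/2) ^ k i)\<^sup>2 * (norm (a k - b k))\<^sup>2) has_sum 0) UNIV"
    by simp
  then have "(\<Prod>i\<in>UNIV. (1/2) ^ k i)\<^sup>2 * (norm (a k - b k))\<^sup>2 = 0"
    by (rule nonneg_has_sum_le_0D) auto
  then show "a k = b k"
    by simp
qed

lemma taylor_coeff_eqI:
  fixes f :: "complex ^ 'n::finite \<Rightarrow> 'a::chilbert_space"
  assumes "has_power_series f a"
  shows "taylor_coeff f = a"
  unfolding taylor_coeff_def using assms power_series_unique by (intro the_equality) auto


section \<open>Multiplication by an inner function is an isometry\<close>

lemma boundary_value_isometric:
  assumes "is_adjoint S T" "S o\<^sub>L T = id_blinfun"
  shows "norm (blinfun_apply T x) = norm x"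
proof -
  have "blinfun_apply S (blinfun_apply T x) = x"
    using arg_cong [OF assms(2), of "\<lambda>U. blinfun_apply U x"] by simp
  then have "cinner (blinfun_apply T x) (blinfun_apply T x) = cinner x x"
    using assms(1) by (simp add: is_adjoint_def)
  then show ?thesis
    by (simp add: cinner_norm flip: of_real_power)
qed

lemma inner_function_torus_AE:
  assumes "inner_function \<Theta>"
  shows "AE t in angle_measure. \<exists>T. (\<forall>x. norm (blinfun_apply T x) = norm x) \<and>
    (\<forall>x. ((\<lambda>r::real. blinfun_apply (\<Theta> (r *\<^sub>R torus_point t)) x) \<longlongrightarrow> blinfun_apply T x) (at_left 1))"
proof -
  have "AE z in torus_measure. \<exists>T S. has_boundary_value \<Theta> z T \<and> is_adjoint S T \<and> S o\<^sub>L T = id_blinfun"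
    using assms by (simp add: inner_function_def)
  from AE_distrD [OF measurable_torus_point this [unfolded torus_measure_eq]]
  show ?thesis
    by (rule eventually_mono) (metis boundary_value_isometric has_boundary_value_def)
qed

text \<open>For a polynomial \<open>h\<close>, Parseval's identity on the torus of radius \<open>r\<close> and dominated
  convergence as \<open>r\<close> tends to \<open>1\<close> show that \<open>\<Theta> h\<close> has the same Hardy space norm as \<open>h\<close>.\<close>

lemma inner_function_polynomial_norm:
  fixes \<Theta> :: "complex ^ 'n::finite \<Rightarrow> 'e::chilbert_space \<Rightarrow>\<^sub>L 'f::chilbert_space"
  assumes inner: "inner_function \<Theta>" and \<Theta>: "has_power_series \<Theta> A" and A: "\<And>k. A k \<in> bounded_ops"
    and supp: "\<And>k. k \<notin> index_box N \<Longrightarrow> a k = 0"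
  shows "((\<lambda>k. (norm (cauchy_product A a k))\<^sup>2) has_sum (\<Sum>k\<in>index_box N. (norm (a k))\<^sup>2)) UNIV"
proof -
  interpret finite_measure "angle_measure :: (real ^ 'n) measure"
    by (rule finite_measure_angle)
  define h where "h = (\<lambda>z. \<Sum>k\<in>index_box N. monomial k z *\<^sub>C a k)"
  define F where "F = (\<lambda>z. blinfun_apply (\<Theta> z) (h z))"
  define C where "C = cauchy_product A a"
  have h_series: "has_power_series h a"
    unfolding has_power_series_def h_def
    using supp by (intro ballI has_sum_finite_neutralI) auto
  have F_series: "has_power_series F C"
    unfolding F_def C_def by (rule has_power_series_product [OF \<Theta> A h_series])
  obtain M where M: "\<And>z. z \<in> polydisc \<Longrightarrow> norm (\<Theta> z) \<le> M"
    using inner by (auto simp: inner_function_def bounded_analytic_def bounded_iff)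
  have "(0 :: complex ^ 'n) \<in> polydisc"
    by (simp add: polydisc_def)
  then have M0: "0 \<le> M"
    using M order_trans [OF norm_ge_zero] by blast
  define B where "B = (\<Sum>k\<in>index_box N. norm (a k))"
  have h_bound: "norm (h (r *\<^sub>R torus_point t)) \<le> B" if "0 < r" "r \<le> 1" for r t
    unfolding h_def B_def
  proof (rule sum_norm_le)
    fix k
    have "(\<Prod>i\<in>(UNIV :: 'n set). r ^ k i) \<le> 1"
      using that by (intro prod_le_1) (auto intro: power_le_one)
    moreover have "0 \<le> (\<Prod>i\<in>(UNIV :: 'n set). r ^ k i)"
      using that by (intro prod_nonneg) auto
    ultimately have "cmod (monomial k (r *\<^sub>R torus_point t)) \<le> 1"
      by (simp add: monomial_scaleR norm_mult del: of_real_prod)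
    then show "norm (monomial k (r *\<^sub>R torus_point t) *\<^sub>C a k) \<le> norm (a k)"
      by (simp add: norm_scaleC mult_left_le_one_le)
  qed
  define r where "r = (\<lambda>n. 1 - 1 / real (n + 2))"
  have r: "0 < r n" "r n < 1" for n
    by (auto simp: r_def)
  have r_lim: "r \<longlonglongrightarrow> 1"
  proof -
    have "(\<lambda>n. 1 - 1 / real (Suc (Suc n))) \<longlonglongrightarrow> 1 - 0"
      by (intro tendsto_diff tendsto_const LIMSEQ_Suc [OF LIMSEQ_inverse_real_of_nat, unfolded inverse_eq_divide])
    then show ?thesis
      by (simp add: r_def)
  qed
  have r_left: "filterlim r (at_left 1) sequentially"
    using r r_lim less_imp_neq [OF r(2)] by (simp add: filterlim_at)
  have measurable: "(\<lambda>t. (norm (F (r n *\<^sub>R torus_point t)))\<^sup>2) \<in> borel_measurable angle_measure"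
    and sums: "((\<lambda>k. (\<Prod>i\<in>UNIV. r n ^ k i)\<^sup>2 * (norm (C k))\<^sup>2) has_sum
      (\<integral>t. (norm (F (r n *\<^sub>R torus_point t)))\<^sup>2 \<partial>angle_measure)) UNIV" for n
    using parseval [OF F_series r] .
  have h_cont: "continuous_on UNIV (\<lambda>t. (norm (h (torus_point t)))\<^sup>2)"
    unfolding h_def by (intro continuous_intros continuous_torus_polynomial)
  have h_lim: "(\<lambda>n. h (r n *\<^sub>R torus_point t)) \<longlonglongrightarrow> h (torus_point t)" for t
  proof -
    have "(\<lambda>n. \<Sum>k\<in>index_box N. complex_of_real (\<Prod>i\<in>UNIV. r n ^ k i) *\<^sub>C monomial k (torus_point t) *\<^sub>C a k)
        \<longlonglongrightarrow> (\<Sum>k\<in>index_box N. complex_of_real (\<Prod>i\<in>(UNIV :: 'n set). 1 ^ k i) *\<^sub>C monomial k (torus_point t) *\<^sub>C a k)"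
      unfolding scaleR_scaleC [symmetric] by (intro tendsto_intros r_lim)
    then show ?thesis
      by (simp add: h_def monomial_scaleR scaleC_scaleC del: of_real_prod)
  qed
  have F_bound: "norm ((norm (F (r n *\<^sub>R torus_point t)))\<^sup>2) \<le> (M * B)\<^sup>2" for n t
  proof -
    have "norm (F (r n *\<^sub>R torus_point t)) \<le> M * B"
      unfolding F_def using r [of n] M0
      by (intro order_trans [OF norm_blinfun] mult_mono M h_bound scaleR_torus_point_in_polydisc) auto
    then show ?thesis
      by (simp add: power_mono)
  qed
  have "AE t in angle_measure. (\<lambda>n. (norm (F (r n *\<^sub>R torus_point t)))\<^sup>2) \<longlonglongrightarrow> (norm (h (torus_point t)))\<^sup>2"
    using inner_function_torus_AE [OF inner]
  proof (rule eventually_mono, elim exE conjE)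
    fix t T
    assume iso: "\<forall>x. norm (blinfun_apply T x) = norm x"
      and T: "\<forall>x. ((\<lambda>r::real. blinfun_apply (\<Theta> (r *\<^sub>R torus_point t)) x) \<longlongrightarrow> blinfun_apply T x) (at_left 1)"
    let ?w = "\<lambda>n. r n *\<^sub>R torus_point t"
    have "(\<lambda>n. blinfun_apply (\<Theta> (?w n)) (h (torus_point t))) \<longlonglongrightarrow> blinfun_apply T (h (torus_point t))"
      using filterlim_compose [OF T [rule_format] r_left] .
    moreover have "(\<lambda>n. blinfun_apply (\<Theta> (?w n)) (h (?w n) - h (torus_point t))) \<longlonglongrightarrow> 0"
    proof (rule Lim_null_comparison)
      show "\<forall>\<^sub>F n in sequentially. norm (blinfun_apply (\<Theta> (?w n)) (h (?w n) - h (torus_point t)))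
          \<le> M * norm (h (?w n) - h (torus_point t))"
        by (intro always_eventually allI order_trans [OF norm_blinfun] mult_right_mono M
            scaleR_torus_point_in_polydisc r) auto
      show "(\<lambda>n. M * norm (h (?w n) - h (torus_point t))) \<longlonglongrightarrow> 0"
        using h_lim [of t] by (intro tendsto_mult_right_zero tendsto_norm_zero LIM_zero)
    qed
    ultimately have "(\<lambda>n. F (?w n)) \<longlonglongrightarrow> blinfun_apply T (h (torus_point t))"
      using tendsto_add [of "\<lambda>n. blinfun_apply (\<Theta> (?w n)) (h (torus_point t))"
          "blinfun_apply T (h (torus_point t))" sequentially
          "\<lambda>n. blinfun_apply (\<Theta> (?w n)) (h (?w n) - h (torus_point t))" 0]
      by (simp add: F_def blinfun.diff_right)
    then have "(\<lambda>n. (norm (F (?w n)))\<^sup>2) \<longlonglongrightarrow> (norm (blinfun_apply T (h (torus_point t))))\<^sup>2"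
      by (intro tendsto_intros)
    then show "(\<lambda>n. (norm (F (?w n)))\<^sup>2) \<longlonglongrightarrow> (norm (h (torus_point t)))\<^sup>2"
      by (simp add: iso)
  qed
  then have "(\<lambda>n. \<integral>t. (norm (F (r n *\<^sub>R torus_point t)))\<^sup>2 \<partial>angle_measure) \<longlonglongrightarrow>
      (\<integral>t. (norm (h (torus_point t)))\<^sup>2 \<partial>angle_measure)"
    using measurable F_bound borel_measurable_continuous_onI [OF h_cont]
    by (intro integral_dominated_convergence [where w = "\<lambda>_. (M * B)\<^sup>2"])
      (auto simp: measurable_cong_sets [OF sets_angle_measure refl])
  moreover define E where "E = (\<Sum>k\<in>index_box N. (norm (a k))\<^sup>2)"
  ultimately have lim: "(\<lambda>n. \<integral>t. (norm (F (r n *\<^sub>R torus_point t)))\<^sup>2 \<partial>angle_measure) \<longlonglongrightarrow> E"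
    by (simp add: h_def parseval_finite)
  have partial: "(\<Sum>k\<in>X. (norm (C k))\<^sup>2) \<le> E" if "finite X" for X
  proof (rule LIMSEQ_le [OF _ lim])
    have "(\<lambda>n. \<Sum>k\<in>X. (\<Prod>i\<in>UNIV. r n ^ k i)\<^sup>2 * (norm (C k))\<^sup>2) \<longlonglongrightarrow>
        (\<Sum>k\<in>X. (\<Prod>i\<in>(UNIV :: 'n set). 1 ^ k i)\<^sup>2 * (norm (C k))\<^sup>2)"
      by (intro tendsto_intros r_lim)
    then show "(\<lambda>n. \<Sum>k\<in>X. (\<Prod>i\<in>UNIV. r n ^ k i)\<^sup>2 * (norm (C k))\<^sup>2) \<longlonglongrightarrow> (\<Sum>k\<in>X. (norm (C k))\<^sup>2)"
      by simp
    show "\<exists>N. \<forall>n\<ge>N. (\<Sum>k\<in>X. (\<Prod>i\<in>UNIV. r n ^ k i)\<^sup>2 * (norm (C k))\<^sup>2) \<le>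
        (\<integral>t. (norm (F (r n *\<^sub>R torus_point t)))\<^sup>2 \<partial>angle_measure)"
      using that by (intro exI allI impI finite_sum_le_has_sum [OF sums]) auto
  qed
  then have summable: "(\<lambda>k. (norm (C k))\<^sup>2) summable_on UNIV"
    by (rule sq_summableI)
  have "(\<Sum>\<^sub>\<infinity>k. (norm (C k))\<^sup>2) = E"
  proof (rule antisym)
    show "(\<Sum>\<^sub>\<infinity>k. (norm (C k))\<^sup>2) \<le> E"
      by (rule infsum_le_finite_sums [OF summable]) (rule partial)
    show "E \<le> (\<Sum>\<^sub>\<infinity>k. (norm (C k))\<^sup>2)"
    proof (rule LIMSEQ_le_const2 [OF lim], intro exI allI impI)
      fix n
      show "(\<integral>t. (norm (F (r n *\<^sub>R torus_point t)))\<^sup>2 \<partial>angle_measure) \<le> (\<Sum>\<^sub>\<infinity>k. (norm (C k))\<^sup>2)"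
      proof (rule has_sum_mono [OF sums has_sum_infsum [OF summable]])
        fix k
        have "(\<Prod>i\<in>(UNIV :: 'n set). r n ^ k i) \<le> 1"
          using r [of n] by (intro prod_le_1) (auto intro: power_le_one)
        moreover have "0 \<le> (\<Prod>i\<in>(UNIV :: 'n set). r n ^ k i)"
          using r [of n] by (intro prod_nonneg) auto
        ultimately show "(\<Prod>i\<in>UNIV. r n ^ k i)\<^sup>2 * (norm (C k))\<^sup>2 \<le> (norm (C k))\<^sup>2"
          by (intro mult_left_le_one_le) (auto intro: power_le_one)
      qed
    qed
  qed
  then show ?thesis
    using has_sum_infsum [OF summable] by (simp add: C_def E_def)
qed

lemma entry_Abs_ell2:
  assumes "(\<lambda>k. (norm (a k))\<^sup>2) summable_on UNIV"
  shows "entry (Abs_ell2 a) = a"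
  using assms by (simp add: Abs_ell2_inverse)

text \<open>The polynomial of the terms with indices in \<^term>\<open>index_box N\<close>.\<close>

definition truncate :: "nat \<Rightarrow> ('n::finite \<Rightarrow> nat, 'a::chilbert_space) ell2 \<Rightarrow> ('n \<Rightarrow> nat, 'a) ell2"
  where "truncate N h = Abs_ell2 (\<lambda>k. if k \<in> index_box N then entry h k else 0)"

lemma truncate_has_sum:
  "((\<lambda>k. (norm (if k \<in> index_box N then entry h k else 0))\<^sup>2) has_sum
    (\<Sum>k\<in>index_box N. (norm (entry h k))\<^sup>2)) UNIV"
  by (rule has_sum_finite_neutralI [OF finite_index_box]) auto

lemma entry_truncate: "entry (truncate N h) k = (if k \<in> index_box N then entry h k else 0)"
  unfolding truncate_def using truncate_has_sum has_sum_imp_summable by (subst entry_Abs_ell2) blast+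

lemma norm_truncate_sq: "(norm (truncate N h))\<^sup>2 = (\<Sum>k\<in>index_box N. (norm (entry h k))\<^sup>2)"
  unfolding norm_ell2_sq entry_truncate by (rule infsumI [OF truncate_has_sum])

lemma truncate_tendsto: "(\<lambda>N. norm (h - truncate N h)) \<longlonglongrightarrow> 0"
proof -
  have "(\<lambda>k. (norm (entry h k))\<^sup>2) summable_on UNIV"
    by (rule sq_summable_entry)
  then have "(\<lambda>N. \<Sum>k\<in>index_box N. (norm (entry h k))\<^sup>2) \<longlonglongrightarrow> (norm h)\<^sup>2"
    unfolding norm_ell2_sq by (intro has_sum_imp_index_box_tendsto has_sum_infsum)
  then have lim: "(\<lambda>N. (norm h)\<^sup>2 - (norm (truncate N h))\<^sup>2) \<longlonglongrightarrow> (norm h)\<^sup>2 - (norm h)\<^sup>2"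
    unfolding norm_truncate_sq by (intro tendsto_diff tendsto_const)
  have "(norm (h - truncate N h))\<^sup>2 = (norm h)\<^sup>2 - (norm (truncate N h))\<^sup>2" for N
  proof -
    have "cinner (truncate N h) (h - truncate N h) = 0"
      unfolding cinner_ell2_def by (rule infsum_0) (simp add: entry_truncate entry_diff)
    from norm_add_sq_orthogonal [OF this] show ?thesis
      by simp
  qed
  with lim have "(\<lambda>N. (norm (h - truncate N h))\<^sup>2) \<longlonglongrightarrow> 0"
    by simp
  then have "(\<lambda>N. sqrt ((norm (h - truncate N h))\<^sup>2)) \<longlonglongrightarrow> sqrt 0"
    by (rule tendsto_real_sqrt)
  then show ?thesis
    by simp
qed

text \<open>The coefficient form of multiplication by \<open>\<Theta>\<close>, where \<open>A\<close> is the family of Taylor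
  coefficients of \<open>\<Theta>\<close>. It is meaningful for families \<open>A\<close> whose Cauchy products with square-summable
  families are square-summable.\<close>

definition mult_op ::
    "(('n::finite \<Rightarrow> nat) \<Rightarrow> 'e::chilbert_space \<Rightarrow>\<^sub>L 'f::chilbert_space) \<Rightarrow>
      ('n \<Rightarrow> nat, 'e) ell2 \<Rightarrow> ('n \<Rightarrow> nat, 'f) ell2"
  where "mult_op A h = Abs_ell2 (cauchy_product A (entry h))"

lemma cauchy_product_add:
  "cauchy_product A (\<lambda>k. a k + b k) k = cauchy_product A a k + cauchy_product A b k"
  by (simp add: cauchy_product_def blinfun.add_right sum.distrib)

lemma cauchy_product_scaleC:
  assumes "\<And>k. A k \<in> bounded_ops"
  shows "cauchy_product A (\<lambda>k. c *\<^sub>C a k) k = c *\<^sub>C cauchy_product A a k"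
  using assms by (simp add: cauchy_product_def bounded_ops_def complex_vector.scale_sum_right)

context
  fixes \<Theta> :: "complex ^ 'n::finite \<Rightarrow> 'e::chilbert_space \<Rightarrow>\<^sub>L 'f::chilbert_space"
    and A :: "('n \<Rightarrow> nat) \<Rightarrow> 'e \<Rightarrow>\<^sub>L 'f"
  assumes inner: "inner_function \<Theta>" and \<Theta>: "has_power_series \<Theta> A" and A: "\<And>k. A k \<in> bounded_ops"
begin

lemma cauchy_product_partial_sum_le:
  assumes "finite X"
  shows "(\<Sum>k\<in>X. (norm (cauchy_product A (entry h) k))\<^sup>2) \<le> (norm h)\<^sup>2"
proof -
  obtain N where N: "X \<subseteq> index_box N"
    using finite_subset_index_box [OF assms] by blast
  have "cauchy_product A (entry h) k = cauchy_product A (entry (truncate N h)) k" if "k \<in> X" for k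
    unfolding cauchy_product_def
  proof (intro sum.cong refl)
    fix j
    have "k - j \<in> index_box N"
      using that N by (auto simp: index_box_def intro: order_trans [OF diff_le_self])
    then show "blinfun_apply (A j) (entry h (k - j)) = blinfun_apply (A j) (entry (truncate N h) (k - j))"
      by (simp add: entry_truncate)
  qed
  then have "(\<Sum>k\<in>X. (norm (cauchy_product A (entry h) k))\<^sup>2) =
      (\<Sum>k\<in>X. (norm (cauchy_product A (entry (truncate N h)) k))\<^sup>2)"
    by simp
  also have "\<dots> \<le> (\<Sum>k\<in>index_box N. (norm (entry (truncate N h) k))\<^sup>2)"
    using assms
    by (intro finite_sum_le_has_sum [OF inner_function_polynomial_norm [OF inner \<Theta> A]])
      (auto simp: entry_truncate)
  also have "\<dots> \<le> (norm h)\<^sup>2"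
    by (simp add: entry_truncate sum_sq_entry_le_norm)
  finally show ?thesis .
qed

lemma entry_mult_op: "entry (mult_op A h) = cauchy_product A (entry h)"
  unfolding mult_op_def using cauchy_product_partial_sum_le
  by (intro entry_Abs_ell2 sq_summableI) blast

lemma mult_op_add: "mult_op A (g + h) = mult_op A g + mult_op A h"
  by (rule ell2_eqI) (simp add: entry_mult_op entry_add cauchy_product_add [symmetric] plus_ell2.rep_eq)

lemma mult_op_scaleC: "mult_op A (c *\<^sub>C h) = c *\<^sub>C mult_op A h"
  by (rule ell2_eqI) (simp add: entry_mult_op cauchy_product_scaleC [OF A, symmetric] scaleC_ell2.rep_eq)

lemma norm_mult_op: "norm (mult_op A h) = norm h"
proof (rule antisym)
  have le: "norm (mult_op A h) \<le> norm h" for h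
    by (rule norm_ell2_leI) (auto simp: entry_mult_op cauchy_product_partial_sum_le)
  show "norm (mult_op A h) \<le> norm h"
    by (rule le)
  have truncate: "norm (mult_op A (truncate N h)) = norm (truncate N h)" for N
  proof (rule power2_eq_imp_eq)
    have "(norm (mult_op A (truncate N h)))\<^sup>2 = (\<Sum>k\<in>index_box N. (norm (entry (truncate N h) k))\<^sup>2)"
      unfolding norm_ell2_sq entry_mult_op
      by (intro infsumI inner_function_polynomial_norm [OF inner \<Theta> A]) (simp add: entry_truncate)
    then show "(norm (mult_op A (truncate N h)))\<^sup>2 = (norm (truncate N h))\<^sup>2"
      by (simp add: norm_truncate_sq entry_truncate)
  qed auto
  have "norm h - 2 * norm (h - truncate N h) \<le> norm (mult_op A h)" for N
  proof -
    have "norm h \<le> norm (truncate N h) + norm (h - truncate N h)"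
      using norm_triangle_ineq [of "truncate N h" "h - truncate N h"] by simp
    moreover have "mult_op A (truncate N h) + mult_op A (h - truncate N h) = mult_op A h"
      by (simp flip: mult_op_add)
    then have "norm (mult_op A (truncate N h)) \<le> norm (mult_op A h) + norm (mult_op A (h - truncate N h))"
      by (metis add_diff_cancel_right' norm_triangle_ineq4)
    ultimately show ?thesis
      using le [of "h - truncate N h"] truncate [of N] by linarith
  qed
  moreover have "(\<lambda>N. norm h - 2 * norm (h - truncate N h)) \<longlonglongrightarrow> norm h - 2 * 0"
    by (intro tendsto_intros truncate_tendsto)
  ultimately show "norm h \<le> norm (mult_op A h)"
    by (intro LIMSEQ_le_const2) auto
qed

end


section \<open>Shifts\<close>

text \<open>The effect on Taylor coefficients of multiplication by the coordinate function \<open>z\<^sub>i\<close>. The case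
  distinction is needed because \<open>k i - 1 = 0\<close> for \<open>k i = 0\<close> in the natural numbers.\<close>

definition shift_seq :: "'n \<Rightarrow> (('n \<Rightarrow> nat) \<Rightarrow> 'a::zero) \<Rightarrow> ('n \<Rightarrow> nat) \<Rightarrow> 'a"
  where "shift_seq i a k = (if k i = 0 then 0 else a (k(i := k i - 1)))"

lemma sum_sq_shift_seq_le:
  fixes a :: "('n \<Rightarrow> nat) \<Rightarrow> 'a::real_normed_vector"
  assumes "(\<lambda>k. (norm (a k))\<^sup>2) summable_on UNIV" and F: "finite F"
  shows "(\<Sum>k\<in>F. (norm (shift_seq i a k))\<^sup>2) \<le> (\<Sum>\<^sub>\<infinity>k. (norm (a k))\<^sup>2)"
proof -
  let ?G = "{k \<in> F. k i \<noteq> 0}" and ?d = "\<lambda>k. k(i := k i - 1)"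
  have "inj_on ?d ?G"
  proof (rule inj_onI)
    fix k l assume kl: "k \<in> ?G" "l \<in> ?G" and eq: "?d k = ?d l"
    have "k x = l x" for x
      using fun_cong [OF eq, of x] kl by (cases "x = i") auto
    then show "k = l"
      by blast
  qed
  then have "(\<Sum>k\<in>?G. (norm (a (?d k)))\<^sup>2) = (\<Sum>k\<in>?d ` ?G. (norm (a k))\<^sup>2)"
    by (simp add: sum.reindex)
  also have "\<dots> \<le> (\<Sum>\<^sub>\<infinity>k. (norm (a k))\<^sup>2)"
    using F by (intro finite_sum_le_infsum assms) auto
  also have "(\<Sum>k\<in>?G. (norm (a (?d k)))\<^sup>2) = (\<Sum>k\<in>F. (norm (shift_seq i a k))\<^sup>2)"
    using F by (intro sum.mono_neutral_cong_left) (auto simp: shift_seq_def)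
  finally show ?thesis .
qed

lemma sum_sq_backshift_le:
  fixes a :: "('n \<Rightarrow> nat) \<Rightarrow> 'a::real_normed_vector"
  assumes "(\<lambda>k. (norm (a k))\<^sup>2) summable_on UNIV" "finite F"
  shows "(\<Sum>k\<in>F. (norm (a (k(i := Suc (k i)))))\<^sup>2) \<le> (\<Sum>\<^sub>\<infinity>k. (norm (a k))\<^sup>2)"
proof -
  let ?u = "\<lambda>k. k(i := Suc (k i))"
  have "inj_on ?u F"
  proof (rule inj_onI)
    fix k l assume eq: "?u k = ?u l"
    have "k x = l x" for x
      using fun_cong [OF eq, of x] by (cases "x = i") auto
    then show "k = l"
      by blast
  qed
  then have "(\<Sum>k\<in>F. (norm (a (?u k)))\<^sup>2) = (\<Sum>k\<in>?u ` F. (norm (a k))\<^sup>2)"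
    by (simp add: sum.reindex)
  also have "\<dots> \<le> (\<Sum>\<^sub>\<infinity>k. (norm (a k))\<^sup>2)"
    using assms by (intro finite_sum_le_infsum) auto
  finally show ?thesis .
qed

text \<open>Multiplication by \<open>z\<^sub>i\<close> as an operator, and its adjoint.\<close>

lift_definition shift ::
    "'n \<Rightarrow> ('n \<Rightarrow> nat, 'a::complex_normed_vector) ell2 \<Rightarrow> ('n \<Rightarrow> nat, 'a) ell2"
  is shift_seq
  by (rule sq_summableI, rule sum_sq_shift_seq_le)

lift_definition backshift ::
    "'n \<Rightarrow> ('n \<Rightarrow> nat, 'a::complex_normed_vector) ell2 \<Rightarrow> ('n \<Rightarrow> nat, 'a) ell2"
  is "\<lambda>i a k. a (k(i := Suc (k i)))"
  by (rule sq_summableI, rule sum_sq_backshift_le)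

lemma entry_shift: "entry (shift i h) k = (if k i = 0 then 0 else entry h (k(i := k i - 1)))"
  by (simp add: shift.rep_eq shift_seq_def)

lemma entry_backshift: "entry (backshift i h) k = entry h (k(i := Suc (k i)))"
  by (simp add: backshift.rep_eq)

lemma shift_add: "shift i (g + h) = shift i g + shift i h"
  by (rule ell2_eqI) (simp add: entry_shift entry_add)

lemma shift_diff: "shift i (g - h) = shift i g - shift i h"
  by (rule ell2_eqI) (simp add: entry_shift entry_diff)

lemma shift_scaleC: "shift i (c *\<^sub>C h) = c *\<^sub>C shift i h"
  by (rule ell2_eqI) (simp add: entry_shift entry_scaleC)

lemma shift_commute: "shift i (shift j h) = shift j (shift i h)"
  by (rule ell2_eqI) (auto simp: entry_shift fun_upd_twist)

lemma norm_backshift_le: "norm (backshift i h) \<le> norm h"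
  by (rule norm_ell2_leI)
    (auto simp: entry_backshift norm_ell2_sq intro: sum_sq_backshift_le [OF sq_summable_entry])

lemma norm_shift_le: "norm (shift i h) \<le> norm h"
  by (rule norm_ell2_leI)
    (auto simp: shift.rep_eq norm_ell2_sq intro: sum_sq_shift_seq_le [OF sq_summable_entry])

lemma cauchy_product_shift:
  fixes A :: "('n::finite \<Rightarrow> nat) \<Rightarrow> 'e::complex_normed_vector \<Rightarrow>\<^sub>L 'f::complex_normed_vector"
  shows "cauchy_product A (shift_seq i a) k = shift_seq i (cauchy_product A a) k"
proof (cases "k i = 0")
  case True
  then show ?thesis
    by (simp add: cauchy_product_def shift_seq_def)
next
  case False
  let ?k = "k(i := k i - 1)"
  have sub: "{..?k} \<subseteq> {..k}"
  proof (rule subsetI)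
    fix j assume "j \<in> {..?k}"
    then have "j x \<le> ?k x" for x
      by (simp add: le_fun_def)
    then have "j x \<le> k x" for x
      by (metis diff_le_self fun_upd_apply le_trans)
    then show "j \<in> {..k}"
      by (simp add: le_fun_def)
  qed
  have "(\<Sum>j\<le>?k. blinfun_apply (A j) (a (?k - j))) = (\<Sum>j\<le>k. blinfun_apply (A j) (shift_seq i a (k - j)))"
  proof (rule sum.mono_neutral_cong_left [OF finite_atMost_multi_index sub], rule ballI)
    fix j assume j: "j \<in> {..k} - {..?k}"
    from j obtain x where "\<not> j x \<le> ?k x"
      by (auto simp: le_fun_def)
    moreover have "j x \<le> k x"
      using j by (simp add: le_fun_def)
    ultimately have "(k - j) i = 0"
      by (cases "x = i") auto
    then show "blinfun_apply (A j) (shift_seq i a (k - j)) = 0"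
      by (simp add: shift_seq_def)
  next
    fix j assume "j \<in> {..?k}"
    then have "j i \<le> ?k i"
      unfolding atMost_iff le_fun_def by blast
    then have "j i < k i"
      using False by simp
    moreover have "?k - j = (k - j)(i := (k - j) i - 1)"
      by (auto simp: fun_eq_iff)
    ultimately show "blinfun_apply (A j) (a (?k - j)) = blinfun_apply (A j) (shift_seq i a (k - j))"
      by (simp add: shift_seq_def)
  qed
  then show ?thesis
    using False by (simp add: cauchy_product_def shift_seq_def)
qed

text \<open>The recursion satisfied by an eigenvector of a unilateral shift has no nonzero solution.\<close>

lemma shift_recursion_zero:
  fixes \<psi> :: "nat \<Rightarrow> 'a::complex_normed_vector"
  assumes "b *\<^sub>C \<psi> 0 = 0" "\<And>m. \<psi> m = b *\<^sub>C \<psi> (Suc m)"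
  shows "\<psi> m = 0"
proof (cases "b = 0")
  case True
  then show ?thesis
    using assms(2) [of m] by simp
next
  case False
  show ?thesis
  proof (induction m)
    case 0
    then show ?case
      using assms(1) False by simp
  next
    case (Suc m)
    then show ?case
      using assms(2) [of m] False by simp
  qed
qed

lemma shift_no_eigenvector:
  assumes "shift i h = b *\<^sub>C h"
  shows "h = 0"
proof (rule ell2_eqI)
  fix k
  have eq: "(if k i = 0 then 0 else entry h (k(i := k i - 1))) = b *\<^sub>C entry h k" for k
    using arg_cong [OF assms, of "\<lambda>f. entry f k"] by (simp add: entry_shift entry_scaleC)
  have "entry h (k(i := m)) = 0" for m
  proof (rule shift_recursion_zero [where b = b])
    show "b *\<^sub>C entry h (k(i := 0)) = 0"
      using eq [of "k(i := 0)"] by simp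
    show "entry h (k(i := m)) = b *\<^sub>C entry h (k(i := Suc m))" for m
      using eq [of "k(i := Suc m)"] by simp
  qed
  from this [of "k i"] show "entry h k = entry 0 k"
    by simp
qed

text \<open>
  The analogue for Hardy space functions of the coprimality of \<open>z\<^sub>i - a\<close> and \<open>z\<^sub>j - b\<close>: if
  \<open>(z\<^sub>j - b) g\<close> is divisible by \<open>z\<^sub>i - a\<close>, where \<open>\<bar>a\<bar> < 1\<close>, then so is \<open>g\<close>. In
  the proof, \<open>E g\<close> contains (at the indices with \<open>k i = 0\<close>) the coefficients of the restriction of
  \<open>g\<close> to \<open>z\<^sub>i = a\<close>, which vanishes, and \<open>u\<close> is the difference quotient.
\<close>

lemma shift_coprime:
  fixes g g' :: "('n \<Rightarrow> nat, 'a::chilbert_space) ell2"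
  assumes ij: "i \<noteq> j" and a: "cmod a < 1"
    and eq: "shift j g - b *\<^sub>C g = shift i g' - a *\<^sub>C g'"
  shows "\<exists>u. g = shift i u - a *\<^sub>C u"
proof -
  have entry_back: "entry ((backshift i ^^ n) h) k = entry h (k(i := k i + n))"
    for h :: "('n \<Rightarrow> nat, 'a) ell2" and n k
    by (induction n arbitrary: k) (simp_all add: entry_backshift)
  have norm_back: "norm ((backshift i ^^ n) h) \<le> norm h" for h :: "('n \<Rightarrow> nat, 'a) ell2" and n
    by (induction n) (auto intro: order_trans [OF norm_backshift_le])
  have summable: "summable (\<lambda>n. a ^ n *\<^sub>C (backshift i ^^ n) h)" for h :: "('n \<Rightarrow> nat, 'a) ell2"
  proof (rule summable_comparison_test')
    show "summable (\<lambda>n. cmod a ^ n * norm h)"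
      using a by (intro summable_mult2 summable_geometric) auto
    show "norm (a ^ n *\<^sub>C (backshift i ^^ n) h) \<le> cmod a ^ n * norm h" for n
      by (simp add: norm_scaleC norm_power mult_left_mono norm_back)
  qed
  define E where "E = (\<lambda>h. \<Sum>n. a ^ n *\<^sub>C (backshift i ^^ n) (h :: ('n \<Rightarrow> nat, 'a) ell2))"
  have entry_summable: "summable (\<lambda>n. a ^ n *\<^sub>C entry h (k(i := k i + n)))" for h :: "('n \<Rightarrow> nat, 'a) ell2" and k
    using bounded_linear.summable [OF bounded_linear_entry summable [of h], of k]
    by (simp add: entry_scaleC entry_back)
  have entry_E: "entry (E h) k = (\<Sum>n. a ^ n *\<^sub>C entry h (k(i := k i + n)))" for h :: "('n \<Rightarrow> nat, 'a) ell2" and k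
    unfolding E_def bounded_linear.suminf [OF bounded_linear_entry summable]
    by (simp add: entry_scaleC entry_back)
  have entry_E_rec: "entry (E h) k = entry h k + a *\<^sub>C entry (E h) (k(i := Suc (k i)))" for h :: "('n \<Rightarrow> nat, 'a) ell2" and k
  proof -
    have "entry (E h) k = entry h k + (\<Sum>n. a ^ Suc n *\<^sub>C entry h (k(i := k i + Suc n)))"
      unfolding entry_E using suminf_split_head [OF entry_summable [of h k]]
      by (simp add: scaleC_one)
    also have "(\<Sum>n. a ^ Suc n *\<^sub>C entry h (k(i := k i + Suc n))) =
        (\<Sum>n. a *\<^sub>C (a ^ n *\<^sub>C entry h ((k(i := Suc (k i)))(i := (k(i := Suc (k i))) i + n))))"
      by (simp add: scaleC_scaleC)
    also have "\<dots> = a *\<^sub>C entry (E h) (k(i := Suc (k i)))"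
      unfolding entry_E by (rule bounded_linear.suminf [OF bounded_linear_scaleC entry_summable, symmetric])
    finally show ?thesis .
  qed
  have E_diff: "entry (E (g - c *\<^sub>C h)) k = entry (E g) k - c *\<^sub>C entry (E h) k" for g h :: "('n \<Rightarrow> nat, 'a) ell2" and c k
  proof -
    have "entry (E (g - c *\<^sub>C h)) k =
        (\<Sum>n. a ^ n *\<^sub>C entry g (k(i := k i + n)) - c *\<^sub>C (a ^ n *\<^sub>C entry h (k(i := k i + n))))"
      unfolding entry_E
      by (simp add: entry_diff entry_scaleC complex_vector.scale_right_diff_distrib scaleC_scaleC mult.commute)
    also have "\<dots> = entry (E g) k - (\<Sum>n. c *\<^sub>C (a ^ n *\<^sub>C entry h (k(i := k i + n))))"
      unfolding entry_E
      by (intro suminf_diff [symmetric] entry_summable bounded_linear.summable [OF bounded_linear_scaleC])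
    also have "(\<Sum>n. c *\<^sub>C (a ^ n *\<^sub>C entry h (k(i := k i + n)))) = c *\<^sub>C entry (E h) k"
      unfolding entry_E by (rule bounded_linear.suminf [OF bounded_linear_scaleC entry_summable, symmetric])
    finally show ?thesis .
  qed
  have E_shift_i: "entry (E (shift i h)) k = a *\<^sub>C entry (E h) k" if "k i = 0" for h :: "('n \<Rightarrow> nat, 'a) ell2" and k
  proof -
    have "entry (E (shift i h)) (k(i := Suc (k i))) = entry (E h) k"
      unfolding entry_E by (simp add: entry_shift that)
    then show ?thesis
      using entry_E_rec [of "shift i h" k] that by (simp add: entry_shift)
  qed
  have E_shift_j: "entry (E (shift j h)) k = (if k j = 0 then 0 else entry (E h) (k(j := k j - 1)))" for h :: "('n \<Rightarrow> nat, 'a) ell2" and k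
    unfolding entry_E using ij by (simp add: entry_shift fun_upd_twist)
  have rec: "(if k j = 0 then 0 else entry (E g) (k(j := k j - 1))) = b *\<^sub>C entry (E g) k"
    if "k i = 0" for k
  proof -
    have "entry (E (shift j g)) k - b *\<^sub>C entry (E g) k = 0"
      using that by (simp add: E_shift_i flip: E_diff) (simp add: eq E_diff E_shift_i)
    then show ?thesis
      by (simp add: E_shift_j)
  qed
  have E_zero: "entry (E g) k = 0" if k: "k i = 0" for k
  proof -
    have "entry (E g) (k(j := m)) = 0" for m
    proof (rule shift_recursion_zero [where b = b])
      show "b *\<^sub>C entry (E g) (k(j := 0)) = 0"
        using rec [of "k(j := 0)"] k ij by simp
      show "entry (E g) (k(j := m)) = b *\<^sub>C entry (E g) (k(j := Suc m))" for m
        using rec [of "k(j := Suc m)"] k ij by simp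
    qed
    from this [of "k j"] show ?thesis
      by simp
  qed
  define u where "u = backshift i (E g)"
  have "g = shift i u - a *\<^sub>C u"
  proof (rule ell2_eqI)
    fix k
    have "entry (shift i u) k = entry (E g) k"
      by (cases "k i = 0") (auto simp: entry_shift u_def entry_backshift E_zero)
    then show "entry g k = entry (shift i u - a *\<^sub>C u) k"
      using entry_E_rec [of g k] by (simp add: entry_diff entry_scaleC u_def entry_backshift)
  qed
  then show ?thesis
    by blast
qed


section \<open>Eigenvectors modulo an invariant subspace\<close>

text \<open>The vector \<open>p(T) f\<close>. The map \<open>T\<close> is an arbitrary function here; linearity is assumed where it
  is used.\<close>

definition poly_apply :: "('a::complex_vector \<Rightarrow> 'a) \<Rightarrow> complex poly \<Rightarrow> 'a \<Rightarrow> 'a"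
  where "poly_apply T p f = (\<Sum>m\<le>degree p. coeff p m *\<^sub>C (T ^^ m) f)"

lemma poly_apply_linear_factor:
  assumes add: "\<And>x y. T (x + y) = T x + T y" and scale: "\<And>c x. T (c *\<^sub>C x) = c *\<^sub>C T x"
    and q: "q \<noteq> 0"
  shows "poly_apply T ([:- a, 1:] * q) f = T (poly_apply T q f) - a *\<^sub>C poly_apply T q f"
proof -
  have T_sum: "T (\<Sum>m\<in>M. g m) = (\<Sum>m\<in>M. T (g m))" if "finite M" for M :: "nat set" and g
    using that
  proof (induction M rule: finite_induct)
    case empty
    show ?case
      using scale [of 0 0] by (simp add: complex_vector.scale_zero_left)
  qed (simp add: add)
  let ?n = "degree q"
  have deg: "degree ([:- a, 1:] * q) = Suc ?n"
    using q by (subst degree_mult_eq) auto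
  have "poly_apply T ([:- a, 1:] * q) f =
      (\<Sum>m\<le>Suc ?n. (coeff (pCons 0 q) m - a * coeff q m) *\<^sub>C (T ^^ m) f)"
    unfolding poly_apply_def deg by (simp only: mult_pCons_left) (simp add: algebra_simps)
  also have "\<dots> = (\<Sum>m\<le>Suc ?n. coeff (pCons 0 q) m *\<^sub>C (T ^^ m) f) -
      (\<Sum>m\<le>Suc ?n. a *\<^sub>C (coeff q m *\<^sub>C (T ^^ m) f))"
    by (simp only: complex_vector.scale_left_diff_distrib sum_subtractf scaleC_scaleC)
  also have "(\<Sum>m\<le>Suc ?n. coeff (pCons 0 q) m *\<^sub>C (T ^^ m) f) = T (poly_apply T q f)"
    by (subst sum.atMost_Suc_shift)
      (simp add: poly_apply_def T_sum scale complex_vector.scale_zero_left)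
  also have "(\<Sum>m\<le>Suc ?n. a *\<^sub>C (coeff q m *\<^sub>C (T ^^ m) f)) = a *\<^sub>C poly_apply T q f"
    by (simp add: poly_apply_def coeff_eq_0 complex_vector.scale_zero_left
        complex_vector.scale_zero_right complex_vector.scale_sum_right)
  finally show ?thesis .
qed

text \<open>If \<open>p(T) f\<close> lies in \<open>W\<close> but \<open>f\<close> does not, then splitting off the roots of \<open>p\<close> one at a
  time produces an eigenvector of \<open>T\<close> modulo \<open>W\<close>. The subspace \<open>K\<close> records a further invariant
  property of this eigenvector.\<close>

lemma eigenvector_modulo_subspace:
  fixes T :: "'a::complex_vector \<Rightarrow> 'a"
  assumes add: "\<And>x y. T (x + y) = T x + T y" and scale: "\<And>c x. T (c *\<^sub>C x) = c *\<^sub>C T x"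
    and W: "complex_vector.subspace W" and K: "complex_vector.subspace K"
    and TK: "\<And>x. x \<in> K \<Longrightarrow> T x \<in> K"
    and "p \<noteq> 0" and f: "f \<in> K" "f \<notin> W" and "poly_apply T p f \<in> W"
  shows "\<exists>a f'. f' \<in> K \<and> f' \<notin> W \<and> T f' - a *\<^sub>C f' \<in> W"
  using \<open>p \<noteq> 0\<close> \<open>poly_apply T p f \<in> W\<close>
proof (induction "degree p" arbitrary: p)
  case 0
  then have "coeff p 0 *\<^sub>C f \<in> W"
    by (simp add: poly_apply_def)
  then have "inverse (coeff p 0) *\<^sub>C (coeff p 0 *\<^sub>C f) \<in> W"
    by (rule complex_vector.subspace_scale [OF W])
  moreover have "coeff p 0 \<noteq> 0"
    using 0 by (metis leading_coeff_0_iff)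
  ultimately show ?case
    using f by (simp add: scaleC_scaleC scaleC_one)
next
  case (Suc n)
  have "\<not> constant (poly p)"
    using Suc.hyps by (simp add: constant_degree)
  then obtain a where "poly p a = 0"
    using fundamental_theorem_of_algebra by blast
  then obtain q where p: "p = [:- a, 1:] * q"
    by (auto simp: poly_eq_0_iff_dvd)
  with Suc.prems have q: "q \<noteq> 0"
    by auto
  show ?case
  proof (cases "poly_apply T q f \<in> W")
    case True
    moreover have "n = degree q"
      using Suc.hyps q unfolding p by (subst (asm) degree_mult_eq) auto
    ultimately show ?thesis
      using Suc.hyps q by blast
  next
    case False
    have "(T ^^ m) f \<in> K" for m
      by (induction m) (auto simp: f TK)
    then have "poly_apply T q f \<in> K"
      unfolding poly_apply_def
      by (intro complex_vector.subspace_sum [OF K] complex_vector.subspace_scale [OF K])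
    moreover have "T (poly_apply T q f) - a *\<^sub>C poly_apply T q f \<in> W"
      using Suc.prems(2) unfolding p poly_apply_linear_factor [OF add scale q] .
    ultimately show ?thesis
      using False by blast
  qed
qed


section \<open>Isometries of finite codimension that commute with two shifts\<close>

text \<open>
  The finite codimension of the range of \<open>V\<close> is expressed by the linear dependence of every sequence
  modulo this range. One shift alone would not suffice: multiplication by a nonconstant
  finite Blaschke product is an isometry of finite nonzero codimension on the Hardy space of the disc.
\<close>

lemma finite_codim_isometry_surj:
  fixes V :: "('n \<Rightarrow> nat, 'e::chilbert_space) ell2 \<Rightarrow> ('n \<Rightarrow> nat, 'f::chilbert_space) ell2"
    and i j :: 'n
  assumes add: "\<And>x y. V (x + y) = V x + V y" and scale: "\<And>c x. V (c *\<^sub>C x) = c *\<^sub>C V x"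
    and norm: "\<And>x. norm (V x) = norm x" and shift: "\<And>i x. V (shift i x) = shift i (V x)"
    and ij: "i \<noteq> j"
    and dep: "\<And>v :: nat \<Rightarrow> _. \<exists>p. p \<noteq> 0 \<and> (\<Sum>m\<le>degree p. coeff p m *\<^sub>C v m) \<in> range V"
    and proj: "\<And>x. \<exists>p\<in>range V. \<forall>w\<in>range V. cinner (x - p) w = 0"
  shows "surj V"
proof (rule ccontr)
  assume "\<not> surj V"
  then obtain f0 where f0: "f0 \<notin> range V"
    by auto
  define W where "W = range V"
  have V_diff: "V (x - y) = V x - V y" for x y
    using add [of "x - y" y] by simp
  have V_inj: "x = y" if "V x = V y" for x y
    using norm [of "x - y"] that by (simp add: V_diff)
  have W: "complex_vector.subspace W"
  proof (rule complex_vector.subspaceI)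
    show "0 \<in> W"
      using scale [of 0 0] by (auto simp: W_def intro: range_eqI [of _ _ 0])
    show "x + y \<in> W" if "x \<in> W" "y \<in> W" for x y
      using that by (auto simp: W_def simp flip: add)
    show "c *\<^sub>C x \<in> W" if "x \<in> W" for c x
      using that by (auto simp: W_def simp flip: scale)
  qed
  have W_shift: "shift i x \<in> W" if "x \<in> W" for i x
    using that by (auto simp: W_def simp flip: shift)
  have W_diff: "x - y \<in> W" if "x \<in> W" "y \<in> W" for x y
    using that by (rule complex_vector.subspace_diff [OF W])
  have W_scale: "c *\<^sub>C x \<in> W" if "x \<in> W" for c x
    using that by (rule complex_vector.subspace_scale [OF W])
  obtain p where p: "p \<noteq> 0" "poly_apply (shift i) p f0 \<in> W"
    using dep [of "\<lambda>m. (shift i ^^ m) f0"] by (auto simp: poly_apply_def W_def)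
  obtain a f1 where f1: "f1 \<notin> W" "shift i f1 - a *\<^sub>C f1 \<in> W"
    using eigenvector_modulo_subspace [OF shift_add shift_scaleC W complex_vector.subspace_UNIV UNIV_I p(1) UNIV_I _ p(2)]
      f0 by (auto simp: W_def)
  define K where "K = {x. shift i x - a *\<^sub>C x \<in> W}"
  have K: "complex_vector.subspace K"
  proof (rule complex_vector.subspaceI)
    show "0 \<in> K"
      using complex_vector.subspace_0 [OF W] shift_scaleC [of i 0 "0 :: ('n \<Rightarrow> nat, 'f) ell2"]
      by (simp add: K_def)
    show "x + y \<in> K" if "x \<in> K" "y \<in> K" for x y
      using complex_vector.subspace_add [OF W that [unfolded K_def mem_Collect_eq]]
      by (simp add: K_def shift_add scaleC_add_right algebra_simps)
    show "c *\<^sub>C x \<in> K" if "x \<in> K" for c x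
      using W_scale [OF that [unfolded K_def mem_Collect_eq], of c]
      by (simp add: K_def shift_scaleC complex_vector.scale_right_diff_distrib scaleC_scaleC mult.commute)
  qed
  have K_shift: "shift j x \<in> K" if "x \<in> K" for x
    using W_shift [OF that [unfolded K_def mem_Collect_eq], of j]
    by (simp add: K_def shift_diff shift_scaleC shift_commute)
  have f1K: "f1 \<in> K"
    using f1 by (simp add: K_def)
  obtain p where p: "p \<noteq> 0" "poly_apply (shift j) p f1 \<in> W"
    using dep [of "\<lambda>m. (shift j ^^ m) f1"] by (auto simp: poly_apply_def W_def)
  obtain b f where f: "f \<in> K" "f \<notin> W" "shift j f - b *\<^sub>C f \<in> W"
    using eigenvector_modulo_subspace [OF shift_add shift_scaleC W K K_shift p(1) f1K f1(1) p(2)] by blast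
  \<comment> \<open>the component \<open>q\<close> of \<open>f\<close> orthogonal to \<open>W\<close> is an eigenvector of the compressed shift, a
    contraction without unimodular eigenvalues\<close>
  have "cmod a < 1"
  proof (rule ccontr)
    assume "\<not> cmod a < 1"
    obtain y where y: "y \<in> W" "\<And>w. w \<in> W \<Longrightarrow> cinner (f - y) w = 0"
      using proj [of f] unfolding W_def by blast
    define q where "q = f - y"
    define w where "w = shift i q - a *\<^sub>C q"
    have "w = (shift i f - a *\<^sub>C f) - (shift i y - a *\<^sub>C y)"
      by (simp add: w_def q_def shift_diff complex_vector.scale_right_diff_distrib)
    then have "w \<in> W"
      using f(1) y(1) by (simp add: K_def W_diff W_shift W_scale)
    then have "cinner (a *\<^sub>C q) w = 0"
      using y(2) by (simp add: q_def cinner_scaleC_left)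
    from norm_add_sq_orthogonal [OF this]
    have "(norm (shift i q))\<^sup>2 = (cmod a)\<^sup>2 * (norm q)\<^sup>2 + (norm w)\<^sup>2"
      by (simp add: w_def norm_scaleC power_mult_distrib)
    moreover have "(norm (shift i q))\<^sup>2 \<le> (norm q)\<^sup>2"
      by (intro power_mono norm_shift_le) simp
    moreover have "1 \<le> (cmod a)\<^sup>2"
      using \<open>\<not> cmod a < 1\<close> by (simp add: one_le_power)
    then have "(norm q)\<^sup>2 \<le> (cmod a)\<^sup>2 * (norm q)\<^sup>2"
      using mult_right_mono [of 1 "(cmod a)\<^sup>2" "(norm q)\<^sup>2"] by simp
    ultimately have "(norm w)\<^sup>2 \<le> 0"
      by linarith
    then have "shift i q = a *\<^sub>C q"
      by (simp add: w_def)
    then have "q = 0"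
      by (rule shift_no_eigenvector)
    then show False
      using f(2) y(1) by (simp add: q_def)
  qed
  obtain g1 where g1: "shift i f - a *\<^sub>C f = V g1"
    using f(1) by (auto simp: K_def W_def)
  obtain g2 where g2: "shift j f - b *\<^sub>C f = V g2"
    using f(3) by (auto simp: W_def)
  have "shift j (shift i f - a *\<^sub>C f) - b *\<^sub>C (shift i f - a *\<^sub>C f) =
      shift i (shift j f - b *\<^sub>C f) - a *\<^sub>C (shift j f - b *\<^sub>C f)"
    by (simp add: shift_diff shift_scaleC shift_commute [of j i] complex_vector.scale_right_diff_distrib
        scaleC_scaleC algebra_simps)
  then have "V (shift j g1 - b *\<^sub>C g1) = V (shift i g2 - a *\<^sub>C g2)"
    unfolding g1 g2 by (simp add: V_diff shift scale)
  then obtain u where u: "g1 = shift i u - a *\<^sub>C u"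
    using shift_coprime [OF ij \<open>cmod a < 1\<close>] V_inj by blast
  have "shift i (f - V u) - a *\<^sub>C (f - V u) = (shift i f - a *\<^sub>C f) - V (shift i u - a *\<^sub>C u)"
    by (simp add: shift_diff V_diff shift scale complex_vector.scale_right_diff_distrib)
  then have "shift i (f - V u) = a *\<^sub>C (f - V u)"
    by (simp add: g1 u)
  then have "f - V u = 0"
    by (rule shift_no_eigenvector)
  then show False
    using f(2) by (simp add: W_def)
qed


section \<open>The model space\<close>

text \<open>The polynomial only serves to collect the coefficients of a nontrivial linear relation.\<close>

lemma finite_dimensional_dependence:
  fixes v :: "nat \<Rightarrow> 'a::complex_vector"
  assumes "\<not> infinite_dimensional M" "\<And>m. v m \<in> M"
  shows "\<exists>p. p \<noteq> 0 \<and> (\<Sum>m\<le>degree p. coeff p m *\<^sub>C v m) = 0"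
proof -
  obtain B where B: "finite B" "M \<subseteq> complex_vector.span B"
    using assms(1) by (auto simp: infinite_dimensional_def)
  have "\<exists>c :: nat \<Rightarrow> complex. (\<exists>m\<le>card B. c m \<noteq> 0) \<and> (\<Sum>m\<le>card B. c m *\<^sub>C v m) = 0"
  proof (cases "inj_on v {..card B}")
    case True
    have "complex_vector.dependent (v ` {..card B})"
    proof (rule ccontr)
      assume "\<not> complex_vector.dependent (v ` {..card B})"
      moreover have "v ` {..card B} \<subseteq> complex_vector.span B"
        using assms(2) B(2) by auto
      ultimately have "card (v ` {..card B}) \<le> card B"
        using complex_vector.independent_span_bound [OF B(1)] by blast
      then show False
        by (simp add: card_image [OF True])
    qed
    then obtain u where u: "\<exists>x\<in>v ` {..card B}. u x \<noteq> 0" "(\<Sum>x\<in>v ` {..card B}. u x *\<^sub>C x) = 0"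
      by (subst (asm) complex_vector.dependent_finite) auto
    from u(2) have "(\<Sum>m\<le>card B. u (v m) *\<^sub>C v m) = 0"
      by (simp add: sum.reindex [OF True])
    with u(1) show ?thesis
      by (intro exI [of _ "\<lambda>m. u (v m)"]) auto
  next
    case False
    then obtain i j where ij: "i \<le> card B" "j \<le> card B" "i \<noteq> j" "v i = v j"
      by (auto simp: inj_on_def)
    have "(\<Sum>m\<le>card B. (if m = i then 1 else if m = j then - 1 else 0) *\<^sub>C v m) =
        (\<Sum>m\<le>card B. (if m = i then v i else 0) - (if m = j then v i else 0))"
      using ij by (intro sum.cong refl) (auto simp: scaleC_one)
    also have "\<dots> = 0"
      using ij by (simp add: sum_subtractf)
    finally show ?thesis
      using ij by (intro exI [of _ "\<lambda>m. if m = i then 1 else if m = j then - 1 else 0"]) auto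
  qed
  then obtain c :: "nat \<Rightarrow> complex" and m0
    where c: "m0 \<le> card B" "c m0 \<noteq> 0" "(\<Sum>m\<le>card B. c m *\<^sub>C v m) = 0"
    by blast
  define p where "p = (\<Sum>m\<le>card B. monom (c m) m)"
  have coeff: "coeff p m = (if m \<le> card B then c m else 0)" for m
    by (simp add: p_def coeff_sum)
  have "degree p \<le> card B"
    by (rule degree_le) (simp add: coeff)
  then have "(\<Sum>m\<le>degree p. coeff p m *\<^sub>C v m) = (\<Sum>m\<le>card B. coeff p m *\<^sub>C v m)"
    by (intro sum.mono_neutral_left) (auto simp: coeff_eq_0 complex_vector.scale_zero_left)
  also have "\<dots> = 0"
    using c(3) by (simp add: coeff)
  finally have "(\<Sum>m\<le>degree p. coeff p m *\<^sub>C v m) = 0" .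
  moreover have "p \<noteq> 0"
    using coeff [of m0] c by auto
  ultimately show ?thesis
    by blast
qed

text \<open>The coefficients of the monomial \<open>z\<^sup>k x\<close>.\<close>

definition single :: "'i \<Rightarrow> 'a::complex_normed_vector \<Rightarrow> ('i, 'a) ell2"
  where "single k x = Abs_ell2 (\<lambda>l. if l = k then x else 0)"

lemma entry_single: "entry (single k x) l = (if l = k then x else 0)"
proof -
  have "((\<lambda>l. (norm (if l = k then x else 0))\<^sup>2) has_sum (norm x)\<^sup>2) UNIV"
    by (rule has_sum_finite_neutralI [of "{k}"]) auto
  then show ?thesis
    unfolding single_def by (subst entry_Abs_ell2) (auto simp: has_sum_imp_summable)
qed

lemma cinner_single: "cinner f (single k x) = cinner (entry f k) x"
proof -
  have "((\<lambda>l. cinner (entry f l) (entry (single k x) l)) has_sum cinner (entry f k) x) UNIV"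
    by (rule has_sum_finite_neutralI [of "{k}"]) (auto simp: entry_single)
  then show ?thesis
    unfolding cinner_ell2_def by (rule infsumI)
qed

lemma cinner_single_left: "cinner (single k x) f = cinner x (entry f k)"
  by (metis cinner_commute cinner_single)

lemma shift_single: "shift i (single k x) = single (k(i := Suc (k i))) x"
  by (rule ell2_eqI) (auto simp: entry_shift entry_single fun_eq_iff)

lemma cauchy_product_single_zero:
  "cauchy_product A (entry (single (\<lambda>_. 0) x)) k = blinfun_apply (A k) x"
proof -
  have "blinfun_apply (A j) (entry (single (\<lambda>_. 0) x) (k - j)) = (if j = k then blinfun_apply (A k) x else 0)"
    if "j \<le> k" for j
  proof -
    have "k - j = (\<lambda>_. 0) \<longleftrightarrow> j = k"
      using that by (auto simp: fun_eq_iff le_fun_def intro: antisym)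
    then show ?thesis
      by (simp add: entry_single)
  qed
  then have "cauchy_product A (entry (single (\<lambda>_. 0) x)) k = (\<Sum>j\<le>k. if j = k then blinfun_apply (A k) x else 0)"
    unfolding cauchy_product_def by (intro sum.cong) auto
  then show ?thesis
    by simp
qed

lemma hardy_of_inj:
  assumes "hardy_of c = 0"
  shows "c = 0"
proof -
  have "has_power_series (hardy_of c) (entry 0)"
    unfolding assms using hardy_of_power_series [of 0] by simp
  with hardy_of_power_series have "entry c = entry 0"
    by (rule power_series_unique)
  then show ?thesis
    by (simp add: entry_inject)
qed

lemma hardy_of_in_model_space:
  assumes \<Theta>: "has_power_series \<Theta> A" "\<And>k. A k \<in> bounded_ops"
    and V: "\<And>h. entry (mult_op A h) = cauchy_product A (entry h)"
    and orth: "\<And>h. cinner c (mult_op A h) = 0"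
  shows "hardy_of c \<in> model_space \<Theta>"
  unfolding model_space_def
proof (intro CollectI conjI ballI hardy_of_in_hardy_space)
  fix g assume "g \<in> mult_range \<Theta>"
  then obtain f where f: "f \<in> hardy_space" and g: "g = (\<lambda>z. blinfun_apply (\<Theta> z) (f z))"
    by (auto simp: mult_range_def)
  obtain h where h: "f = hardy_of h"
    using hardy_space_eq_hardy_of [OF f] .
  have "taylor_coeff g = entry (mult_op A h)"
    unfolding g h V by (intro taylor_coeff_eqI has_power_series_product \<Theta> hardy_of_power_series)
  moreover have "taylor_coeff (hardy_of c) = entry c"
    by (intro taylor_coeff_eqI hardy_of_power_series)
  ultimately show "hardy_inner (hardy_of c) g = 0"
    using orth [of h] by (simp add: hardy_inner_def cinner_ell2_def)
qed

theorem theorem8p4: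
  fixes \<Theta> :: "complex ^ 'n::finite \<Rightarrow>
      'e::{chilbert_space, second_countable_topology} \<Rightarrow>\<^sub>L
      'f::{chilbert_space, second_countable_topology}"
  assumes "CARD('n) \<ge> 2"
    and "inner_function \<Theta>"
    and "nonconstant_on_polydisc \<Theta>"
  shows "infinite_dimensional (model_space \<Theta>)"
proof (rule ccontr)
  assume fin: "\<not> infinite_dimensional (model_space \<Theta>)"
  obtain A where A: "\<And>k. A k \<in> bounded_ops" and \<Theta>: "has_power_series \<Theta> A"
    using assms(2) by (auto simp: inner_function_def bounded_analytic_def)
  define V where "V = mult_op A"
  note entry_V = entry_mult_op [OF assms(2) \<Theta> A]
  have add: "V (g + h) = V g + V h" for g h
    unfolding V_def by (rule mult_op_add [OF assms(2) \<Theta> A])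
  have scale: "V (c *\<^sub>C h) = c *\<^sub>C V h" for c h
    unfolding V_def by (rule mult_op_scaleC [OF assms(2) \<Theta> A])
  have norm: "norm (V h) = norm h" for h
    unfolding V_def by (rule norm_mult_op [OF assms(2) \<Theta> A])
  have shift: "V (shift i h) = shift i (V h)" for i h
    by (rule ell2_eqI) (simp add: V_def entry_V shift.rep_eq cauchy_product_shift)
  have bl: "bounded_linear V"
    by (rule bounded_linear_intro [where K = 1]) (simp_all add: add scale scaleR_scaleC norm)
  have "complete (range V)"
    by (rule complete_isometric_image [of 1, OF _ subspace_UNIV bl _ complete_UNIV]) (simp_all add: norm)
  then have proj: "\<exists>p\<in>range V. \<forall>w\<in>range V. cinner (x - p) w = 0" for x
  proof (rule orthogonal_projection_exists)
    show "0 \<in> range V"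
      using scale [of 0 0] by (auto intro: range_eqI [of _ _ 0])
  qed (auto simp flip: add scale)
  have dep: "\<exists>p. p \<noteq> 0 \<and> (\<Sum>m\<le>degree p. coeff p m *\<^sub>C v m) \<in> range V" for v :: "nat \<Rightarrow> _"
  proof -
    have "\<forall>x. \<exists>p. p \<in> range V \<and> (\<forall>w\<in>range V. cinner (x - p) w = 0)"
      by (intro allI proj [unfolded Bex_def])
    from choice [OF this]
    obtain P where "\<forall>x. P x \<in> range V \<and> (\<forall>w\<in>range V. cinner (x - P x) w = 0)" ..
    then have P: "\<And>x. P x \<in> range V" "\<And>x w. w \<in> range V \<Longrightarrow> cinner (x - P x) w = 0"
      by blast+
    have "hardy_of (v m - P (v m)) \<in> model_space \<Theta>" for m
      using P(2) by (intro hardy_of_in_model_space [OF \<Theta> A entry_V]) (auto simp: V_def)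
    then obtain p where p: "p \<noteq> 0" "(\<Sum>m\<le>degree p. coeff p m *\<^sub>C hardy_of (v m - P (v m))) = 0"
      using finite_dimensional_dependence [OF fin, of "\<lambda>m. hardy_of (v m - P (v m))"] by blast
    then have "hardy_of (\<Sum>m\<le>degree p. coeff p m *\<^sub>C (v m - P (v m))) = 0"
      by (simp add: hardy_of_sum hardy_of_scaleC)
    then have "(\<Sum>m\<le>degree p. coeff p m *\<^sub>C (v m - P (v m))) = 0"
      by (rule hardy_of_inj)
    then have "(\<Sum>m\<le>degree p. coeff p m *\<^sub>C v m) = (\<Sum>m\<le>degree p. coeff p m *\<^sub>C P (v m))"
      by (simp add: complex_vector.scale_right_diff_distrib sum_subtractf)
    also have "\<dots> \<in> range V"
    proof -
      have "\<forall>m. \<exists>h. P (v m) = V h"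
        using P(1) by blast
      then obtain h where "\<And>m. P (v m) = V (h m)"
        by metis
      then have "(\<Sum>m\<le>degree p. coeff p m *\<^sub>C P (v m)) = V (\<Sum>m\<le>degree p. coeff p m *\<^sub>C h m)"
        by (simp add: scale bounded_linear.linear [OF bl] linear_sum)
      then show ?thesis
        by simp
    qed
    finally show ?thesis
      using p(1) by blast
  qed
  have "\<not> CARD('n) \<le> Suc 0"
    using assms(1) by simp
  then obtain i j :: 'n where ij: "i \<noteq> j"
    by (auto simp: card_le_Suc0_iff_eq)
  have "surj V"
    by (rule finite_codim_isometry_surj [OF add scale norm shift ij dep proj])
  have A_zero: "A k = 0" if k: "k \<noteq> (\<lambda>_. 0)" for k
  proof (rule blinfun_eqI)
    fix x
    define y where "y = blinfun_apply (A k) x"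
    obtain i where i: "k i \<noteq> 0"
      using k by auto
    obtain g where g: "single (k(i := k i - 1)) y = V g"
      using surjD [OF \<open>surj V\<close>] by blast
    \<comment> \<open>a surjective isometry that commutes with the shift maps the orthogonal complement of the
      range of the shift into itself\<close>
    have "single k y = V (shift i g)"
      using i by (simp add: shift g [symmetric] shift_single)
    then have "cinner (V (single (\<lambda>_. 0) x)) (single k y) = cinner (single (\<lambda>_. 0) x) (shift i g)"
      by (simp add: isometry_preserves_cinner [OF add scale norm])
    also have "\<dots> = 0"
      by (simp add: cinner_single_left entry_shift)
    also have "cinner (V (single (\<lambda>_. 0) x)) (single k y) = cinner y y"
      by (simp add: cinner_single V_def entry_V cauchy_product_single_zero y_def)
    finally show "blinfun_apply (A k) x = blinfun_apply 0 x"
      by (simp add: cinner_self_eq_0 y_def)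
  qed
  have "\<Theta> z = A (\<lambda>_. 0)" if z: "z \<in> polydisc" for z
  proof (rule has_sum_unique)
    show "((\<lambda>k. monomial k z *\<^sub>C A k) has_sum \<Theta> z) UNIV"
      using \<Theta> z by (simp add: has_power_series_def)
    show "((\<lambda>k. monomial k z *\<^sub>C A k) has_sum A (\<lambda>_. 0)) UNIV"
      by (rule has_sum_finite_neutralI [of "{\<lambda>_. 0}"]) (auto simp: A_zero monomial_def scaleC_one)
  qed
  then show False
    using assms(3) by (auto simp: nonconstant_on_polydisc_def)
qed

end
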